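(* Let $[\mu]\in\mathcal A_n$ be a critical point of $F_n$ with $\mathrm M_\mu=c_\mu I+D_\mu$, $c_\mu\in\mathbb R$, $D_\mu\in\mathrm{Der}(\mu)$. Consider the orthogonal decomposition $\mathbb C^n=\mathfrak A_-\oplus\mathfrak A_0\oplus\mathfrak A_+$, where $\mathfrak A_-$, $\mathfrak A_0$, $\mathfrak A_+$ are the sums of eigenspaces of the Hermitian operator $D_\mu$ for eigenvalues $<0$, $=0$, $>0$ respectively. Then: (i) $\mathrm{ann}(\mu)\subset\mathfrak A_+$; (ii) $\mathfrak A_+\subset N(\mu)$; (iii) $\mathfrak A_-\subset C(\mu)\cap N(\mu)$ and $\mathfrak A_-\cap\mathrm{ann}(\mu)=0$; (iv) $(L^\mu_A-R^\mu_A)^*\in\mathrm{Der}(\mu)$ for every $A\in\mathfrak A_0$; consequently the Lie algebra $(\mathfrak A_0,[A,B]=\mu(A,B)-\mu(B,A))$ is reductive.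
   Context: $V_n$ is the space of bilinear maps $\mu:\mathbb C^n\times\mathbb C^n\to\mathbb C^n$ with standard Hermitian structures; $\mathcal A_n\subset\mathbb PV_n$ is the projectivization of the set of associative $\mu$, and a critical point of $F_n$ on $\mathcal A_n$ is a point of $\mathcal A_n$ that is a critical point of $F_n$ on $\mathbb PV_n$. $L^\mu_XY=\mu(X,Y)$, $R^\mu_XY=\mu(Y,X)$, $\mathrm M_\mu=2\sum_i L^\mu_{X_i}(L^\mu_{X_i})^*-2\sum_i (L^\mu_{X_i})^*L^\mu_{X_i}-2\sum_i (R^\mu_{X_i})^*R^\mu_{X_i}$ ($\{X_i\}$ orthonormal), $F_n([\mu])=\operatorname{tr}\mathrm M_\mu^2/\|\mu\|^4$; $[\mu]$ is critical iff $\mathrm M_\mu=c_\mu I+D_\mu$ with $c_\mu\in\mathbb R$, $D_\mu$ a derivation. For the associative algebra $\mu$: $C(\mu)=\{x:\mu(x,y)=\mu(y,x)\ \forall y\}$ (center), $\mathrm{ann}(\mu)=\{x:\mu(x,y)=\mu(y,x)=0\ \forall y\}$ (annihilator), and $N(\mu)$ is the radical, the largest nilpotent ideal. *)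

theory Defs
  imports "HOL-Analysis.Analysis"
begin

text \<open>A bilinear map mu : C^n x C^n -> C^n is given by its structure constants
  with respect to the standard (orthonormal) basis: mu(e_i, e_j) = sum_k sc i j k e_k.
  The dimension n is the cardinality of the finite index type 'n.\<close>

type_synonym 'n bilin = "'n \<Rightarrow> 'n \<Rightarrow> 'n \<Rightarrow> complex"

definition mult :: "'n::finite bilin \<Rightarrow> complex^'n \<Rightarrow> complex^'n \<Rightarrow> complex^'n" where
  "mult sc x y = (\<chi> k. \<Sum>i\<in>UNIV. \<Sum>j\<in>UNIV. x$i * y$j * sc i j k)"

definition Lmat :: "'n::finite bilin \<Rightarrow> complex^'n \<Rightarrow> complex^'n^'n" where
  "Lmat sc x = (\<chi> k j. \<Sum>i\<in>UNIV. x$i * sc i j k)"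

definition Rmat :: "'n::finite bilin \<Rightarrow> complex^'n \<Rightarrow> complex^'n^'n" where
  "Rmat sc x = (\<chi> k i. \<Sum>j\<in>UNIV. x$j * sc i j k)"

definition adj :: "complex^'n^'m \<Rightarrow> complex^'m^'n" where
  "adj A = (\<chi> i j. cnj (A$j$i))"

definition ebasis :: "'n::finite \<Rightarrow> complex^'n" where
  "ebasis i = axis i 1"

definition Mmu :: "'n::finite bilin \<Rightarrow> complex^'n^'n" where
  "Mmu sc =
     2 *\<^sub>R (\<Sum>i\<in>UNIV. Lmat sc (ebasis i) ** adj (Lmat sc (ebasis i)))
   - 2 *\<^sub>R (\<Sum>i\<in>UNIV. adj (Lmat sc (ebasis i)) ** Lmat sc (ebasis i))
   - 2 *\<^sub>R (\<Sum>i\<in>UNIV. adj (Rmat sc (ebasis i)) ** Rmat sc (ebasis i))"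

definition associative :: "'n::finite bilin \<Rightarrow> bool" where
  "associative sc \<longleftrightarrow> (\<forall>x y z. mult sc (mult sc x y) z = mult sc x (mult sc y z))"

definition derivation :: "'n::finite bilin \<Rightarrow> complex^'n^'n \<Rightarrow> bool" where
  "derivation sc D \<longleftrightarrow>
     (\<forall>x y. D *v mult sc x y = mult sc (D *v x) y + mult sc x (D *v y))"

definition cspan :: "(complex^'n) set \<Rightarrow> (complex^'n) set" where
  "cspan S = {x. \<exists>t r. finite t \<and> t \<subseteq> S \<and> x = (\<Sum>a\<in>t. r a *s a)}"

definition csubspace :: "(complex^'n) set \<Rightarrow> bool" where
  "csubspace S \<longleftrightarrow> 0 \<in> S \<and> (\<forall>x\<in>S. \<forall>y\<in>S. x + y \<in> S) \<and> (\<forall>c. \<forall>x\<in>S. c *s x \<in> S)"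

definition Aneg :: "complex^'n^'n \<Rightarrow> (complex^'n) set" where
  "Aneg D = cspan {v. \<exists>r::real. r < 0 \<and> D *v v = complex_of_real r *s v}"

definition Azero :: "complex^'n^'n \<Rightarrow> (complex^'n) set" where
  "Azero D = cspan {v. D *v v = complex_of_real 0 *s v}"

definition Apos :: "complex^'n^'n \<Rightarrow> (complex^'n) set" where
  "Apos D = cspan {v. \<exists>r::real. r > 0 \<and> D *v v = complex_of_real r *s v}"

definition center :: "'n::finite bilin \<Rightarrow> (complex^'n) set" where
  "center sc = {x. \<forall>y. mult sc x y = mult sc y x}"

definition ann :: "'n::finite bilin \<Rightarrow> (complex^'n) set" where
  "ann sc = {x. \<forall>y. mult sc x y = 0 \<and> mult sc y x = 0}"

fun lprod :: "'n::finite bilin \<Rightarrow> (complex^'n) list \<Rightarrow> complex^'n" where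
  "lprod sc [] = 0"
| "lprod sc (x # xs) = foldl (mult sc) x xs"

definition alg_ideal :: "'n::finite bilin \<Rightarrow> (complex^'n) set \<Rightarrow> bool" where
  "alg_ideal sc I \<longleftrightarrow> csubspace I \<and>
     (\<forall>x\<in>I. \<forall>y. mult sc x y \<in> I \<and> mult sc y x \<in> I)"

definition nilpotent_ideal :: "'n::finite bilin \<Rightarrow> (complex^'n) set \<Rightarrow> bool" where
  "nilpotent_ideal sc I \<longleftrightarrow> alg_ideal sc I \<and>
     (\<exists>k\<ge>1. \<forall>xs. length xs = k \<longrightarrow> set xs \<subseteq> I \<longrightarrow> lprod sc xs = 0)"

definition radical :: "'n::finite bilin \<Rightarrow> (complex^'n) set" where
  "radical sc = (THE I. nilpotent_ideal sc I \<and> (\<forall>J. nilpotent_ideal sc J \<longrightarrow> J \<subseteq> I))"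

definition lie_ideal :: "(complex^'n) set \<Rightarrow> (complex^'n \<Rightarrow> complex^'n \<Rightarrow> complex^'n)
    \<Rightarrow> (complex^'n) set \<Rightarrow> bool" where
  "lie_ideal g br I \<longleftrightarrow> csubspace I \<and> I \<subseteq> g \<and> (\<forall>x\<in>g. \<forall>y\<in>I. br x y \<in> I)"

text \<open>Reductive: the adjoint representation is completely reducible, i.e. every ideal
  has a complementary ideal.\<close>
definition reductive :: "(complex^'n) set \<Rightarrow> (complex^'n \<Rightarrow> complex^'n \<Rightarrow> complex^'n) \<Rightarrow> bool" where
  "reductive g br \<longleftrightarrow> (\<forall>I. lie_ideal g br I \<longrightarrow>
     (\<exists>J. lie_ideal g br J \<and> I \<inter> J = {0} \<and> g = {x + y | x y. x \<in> I \<and> y \<in> J}))"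

definition commutator :: "'n::finite bilin \<Rightarrow> complex^'n \<Rightarrow> complex^'n \<Rightarrow> complex^'n" where
  "commutator sc a b = mult sc a b - mult sc b a"

end

theory Submission
  imports Defs
begin

text \<open>Write \<open>act\<close> for the infinitesimal action of matrices on bilinear maps. The moment map
  satisfies \<open>tr (M E) = 2 \<langle>act E \<mu>, \<mu>\<rangle>\<close>, and \<open>act A \<mu> = 0\<close> says that \<open>A\<close> is a derivation. Taking
  \<open>E = D\<close> gives \<open>tr M\<^sup>2 = c tr M = - 2 c \<parallel>\<mu>\<parallel>\<^sup>2\<close>, so \<open>c < 0\<close>; an eigenvector \<open>x\<close> of \<open>D\<close> in the
  annihilator has \<open>\<langle>M x, x\<rangle> \<ge> 0\<close>, so its eigenvalue is at least \<open>- c > 0\<close>. For \<open>D x = r x\<close> the derivation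
  \<open>A = L x - R x\<close> satisfies \<open>[D, A] = r A\<close>, and \<open>E = [A, A\<^sup>*]\<close> gives
  \<open>r \<parallel>A\<parallel>\<^sup>2 = 2 \<parallel>act A\<^sup>* \<mu>\<parallel>\<^sup>2\<close>: for \<open>r < 0\<close> the element \<open>x\<close> is central, for \<open>r = 0\<close> the adjoint
  \<open>A\<^sup>*\<close> is again a derivation.

  Eigenvectors with \<open>r < 0\<close> are nilpotent because powers multiply the eigenvalue, and central nilpotent
  elements lie in the radical. Modulo the radical only eigenvalues \<open>\<ge> 0\<close> remain, so the eigenvectors with
  \<open>r > 0\<close> span, together with the radical, a nil ideal; nil ideals are nilpotent. Finally, if all adjoint
  operators of \<open>ad A\<close> are derivations, then every ideal of the Lie algebra is stable under them, so
  its orthogonal complement is an ideal.\<close>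

section \<open>Self-adjoint operators\<close>

text \<open>A maximum of the Rayleigh quotient on the unit sphere of \<open>W\<close> is an
  eigenvector: its first variation in every direction of \<open>W\<close> vanishes.\<close>

lemma selfadjoint_eigenvector_exists:
  fixes f :: "'a::euclidean_space \<Rightarrow> 'a"
  assumes lin: "linear f" and sym: "\<And>x y. f x \<bullet> y = x \<bullet> f y"
    and W: "subspace W" and inv: "f ` W \<subseteq> W" and ne: "W \<noteq> {0}"
  obtains v r where "v \<in> W" "v \<noteq> 0" "f v = r *\<^sub>R v"
proof -
  interpret f: linear f by (rule lin)
  let ?S = "sphere 0 1 \<inter> W"
  have "compact ?S"
    by (intro compact_Int_closed compact_sphere closed_subspace W)
  moreover obtain w where w: "w \<in> W" "w \<noteq> 0"
    using ne subspace_0[OF W] by auto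
  then have "(1 / norm w) *\<^sub>R w \<in> ?S"
    using subspace_scale[OF W] by auto
  then have "?S \<noteq> {}" by blast
  moreover have "continuous_on ?S (\<lambda>x. f x \<bullet> x)"
    by (intro continuous_intros linear_continuous_on) (use lin linear_conv_bounded_linear in blast)
  ultimately obtain v where v: "v \<in> ?S" and max: "\<And>x. x \<in> ?S \<Longrightarrow> f x \<bullet> x \<le> f v \<bullet> v"
    using continuous_attains_sup[of ?S "\<lambda>x. f x \<bullet> x"] by blast
  define m where "m = f v \<bullet> v"
  have vv: "v \<bullet> v = 1" "v \<in> W" "v \<noteq> 0"
    using v by (auto simp: dot_square_norm)
  have le: "f x \<bullet> x \<le> m * (x \<bullet> x)" if "x \<in> W" for x
  proof (cases "x = 0")
    case True
    then show ?thesis by (simp add: f.zero)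
  next
    case False
    then have "(1 / norm x) *\<^sub>R x \<in> ?S"
      using subspace_scale[OF W that] by auto
    from max[OF this] show ?thesis using False
      by (simp add: f.scale m_def power2_norm_eq_inner[symmetric] field_simps power2_eq_square)
  qed
  have orth: "m * (v \<bullet> w) - f v \<bullet> w = 0" if w: "w \<in> W" for w
  proof (rule ccontr)
    define b where "b = m * (v \<bullet> w) - f v \<bullet> w"
    define q where "q = m * (w \<bullet> w) - f w \<bullet> w"
    assume "m * (v \<bullet> w) - f v \<bullet> w \<noteq> 0"
    then have b: "b \<noteq> 0" by (simp add: b_def)
    \<comment> \<open>This is \<open>le\<close> at \<open>v + t w\<close>; the constant term drops
      out because \<open>v\<close> attains the maximum.\<close>
    have quad: "0 \<le> 2 * t * b + t\<^sup>2 * q" for t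
    proof -
      have "v + t *\<^sub>R w \<in> W"
        using vv w by (intro subspace_add[OF W] subspace_scale[OF W])
      from le[OF this] show ?thesis
        using sym[of w v]
        by (simp add: f.add f.scale b_def q_def inner_add_left inner_add_right vv m_def[symmetric]
            inner_commute[of w v] inner_commute[of w "f v"] algebra_simps power2_eq_square)
    qed
    have "q \<ge> 0" using le[OF w] by (simp add: q_def)
    \<comment> \<open>A step against the slope \<open>b\<close>; dividing by \<open>q + 1\<close>
      instead of \<open>q\<close> also covers \<open>q = 0\<close>.\<close>
    define t where "t = - b / (q + 1)"
    have bt: "b = - (q + 1) * t" and "t \<noteq> 0"
      using \<open>q \<ge> 0\<close> b by (auto simp: t_def field_simps)
    have "0 \<le> 2 * t * b + t\<^sup>2 * q" by (rule quad)
    also have "\<dots> = - (t\<^sup>2 * (q + 2))"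
      unfolding bt by (simp add: power2_eq_square algebra_simps)
    also have "\<dots> < 0"
      using \<open>q \<ge> 0\<close> \<open>t \<noteq> 0\<close> by simp
    finally show False by simp
  qed
  have "m *\<^sub>R v - f v \<in> W"
    using vv inv by (intro subspace_diff[OF W] subspace_scale[OF W]) auto
  from orth[OF this] have "(m *\<^sub>R v - f v) \<bullet> (m *\<^sub>R v - f v) = 0"
    by (simp add: inner_diff_left)
  then have "f v = m *\<^sub>R v" by simp
  with vv that show thesis by blast
qed

text \<open>The part \<open>K\<close> of \<open>W\<close> orthogonal to all eigenvectors in
  \<open>W\<close> is again invariant, so a nonzero \<open>K\<close> would contain an eigenvector
  orthogonal to itself.\<close>

lemma selfadjoint_span_eigenvectors:
  fixes f :: "'a::euclidean_space \<Rightarrow> 'a"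
  assumes lin: "linear f" and sym: "\<And>x y. f x \<bullet> y = x \<bullet> f y"
    and W: "subspace W" and inv: "f ` W \<subseteq> W"
  shows "W \<subseteq> span {v \<in> W. \<exists>r. f v = r *\<^sub>R v}"
proof
  interpret f: linear f by (rule lin)
  define E where "E = {v \<in> W. \<exists>r. f v = r *\<^sub>R v}"
  define K where "K = {w \<in> W. \<forall>e\<in>E. w \<bullet> e = 0}"
  have K: "subspace K"
    using W by (auto simp: K_def subspace_def inner_add_left)
  have "f ` K \<subseteq> K"
    using inv by (auto simp: K_def sym) (auto simp: E_def)
  have "K = {0}"
  proof (rule ccontr)
    assume "K \<noteq> {0}"
    then obtain v r where "v \<in> K" "v \<noteq> 0" "f v = r *\<^sub>R v"
      using selfadjoint_eigenvector_exists[OF lin sym K \<open>f ` K \<subseteq> K\<close>] by metis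
    then show False by (auto simp: K_def E_def)
  qed
  fix x assume x: "x \<in> W"
  obtain y z where yz: "y \<in> span E" "\<And>w. w \<in> span E \<Longrightarrow> orthogonal z w" "x = y + z"
    using orthogonal_subspace_decomp_exists[of E x] by blast
  have "y \<in> W" using yz(1) span_minimal[of E W] W by (auto simp: E_def)
  then have "z \<in> W" using subspace_diff[OF W x \<open>y \<in> W\<close>] yz(3) by simp
  then have "z \<in> K" using yz(2) span_base[of _ E] by (auto simp: K_def orthogonal_def)
  then show "x \<in> span {v \<in> W. \<exists>r. f v = r *\<^sub>R v}"
    using yz \<open>K = {0}\<close> by (simp add: E_def)
qed

section \<open>Lie algebras of derivations closed under adjoints\<close>

text \<open>\<open>st x\<close> is the adjoint of \<open>br x\<close>. The bracket is a Lie bracket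
  on the whole space, whereas the adjoints are derivations only over \<open>g\<close>. The instance
  in view is the commutator with \<open>g\<close> the kernel of \<open>D\<close>.\<close>

locale adjoint_closed_lie =
  fixes br st :: "'a::euclidean_space \<Rightarrow> 'a \<Rightarrow> 'a" and g :: "'a set"
  assumes lin_left: "linear (\<lambda>x. br x y)"
    and skew: "br x y = - br y x"
    and jacobi: "br (br x y) z = br x (br y z) - br y (br x z)"
    and st: "br x y \<bullet> z = y \<bullet> st x z"
    and g: "subspace g"
    and br_closed: "x \<in> g \<Longrightarrow> y \<in> g \<Longrightarrow> br x y \<in> g"
    and st_closed: "x \<in> g \<Longrightarrow> y \<in> g \<Longrightarrow> st x y \<in> g"
    and st_derivation: "x \<in> g \<Longrightarrow> y \<in> g \<Longrightarrow> z \<in> g \<Longrightarrow> st x (br y z) = br (st x y) z + br y (st x z)"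
begin

lemma lin_right: "linear (br x)"
  using linear_compose[OF lin_left[of x] bounded_linear.linear[OF bounded_linear_minus[OF bounded_linear_ident]]]
  by (simp add: o_def skew[of x, symmetric])

lemma st_linear: "linear (st x)"
proof
  fix y z :: 'a and r :: real
  show "st x (y + z) = st x y + st x z"
    by (rule vector_eq_ldot[THEN iffD1]) (simp add: st[symmetric] inner_add_right)
  show "st x (r *\<^sub>R y) = r *\<^sub>R st x y"
    by (rule vector_eq_ldot[THEN iffD1]) (simp add: st[symmetric])
qed

text \<open>Pairing \<open>k\<close> with \<open>br x (st x k)\<close> gives
  \<open>st x k = 0\<close>. So the derivation \<open>st x\<close> commutes with \<open>br k\<close>
  on \<open>g\<close>, and by adjunction \<open>st k\<close> commutes with \<open>br x\<close>. The
  Leibniz rule for \<open>st k\<close> then leaves \<open>br (st k x) k = 0\<close>, which forces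
  \<open>st k = 0\<close> and hence \<open>br k = 0\<close> on \<open>g\<close>.\<close>

lemma orthogonal_derived_central:
  assumes k: "k \<in> g" and orth: "\<And>x y. x \<in> g \<Longrightarrow> y \<in> g \<Longrightarrow> br x y \<bullet> k = 0"
    and y: "y \<in> g"
  shows "br k y = 0"
proof -
  have stk: "st x k = 0" if "x \<in> g" for x
    using orth[OF that st_closed[OF that k]] by (simp add: st)
  have comm: "st x (br k w) = br k (st x w)" if "x \<in> g" "w \<in> g" for x w
    using st_derivation[OF that(1) k that(2)] stk[OF that(1)] linear_0[OF lin_left] by simp
  have comm': "st k (br x z) = br x (st k z)" if x: "x \<in> g" and z: "z \<in> g" for x z
  proof -
    \<comment> \<open>The commutation can be tested only against vectors of \<open>g\<close>; this
      suffices because the difference itself lies in \<open>g\<close>.\<close>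
    define u where "u = st k (br x z) - br x (st k z)"
    have "u \<in> g"
      unfolding u_def using k x z by (intro subspace_diff[OF g] st_closed br_closed)
    have "st k (br x z) \<bullet> w = br x (st k z) \<bullet> w" if "w \<in> g" for w
    proof -
      have "st k (br x z) \<bullet> w = br x z \<bullet> br k w" by (metis inner_commute st)
      also have "\<dots> = z \<bullet> br k (st x w)" using comm[OF x that] by (simp add: st)
      also have "\<dots> = br x (st k z) \<bullet> w" by (metis inner_commute st)
      finally show ?thesis .
    qed
    from this[OF \<open>u \<in> g\<close>] have "u \<bullet> u = 0" by (simp add: u_def inner_diff_left)
    then show ?thesis by (simp add: u_def)
  qed
  have "st k x = 0" if x: "x \<in> g" for x
  proof -
    have "br (st k x) k = 0"
      using st_derivation[OF k x k] comm'[OF x k] by simp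
    then have "br k (st k x) = 0" using skew[of k] by simp
    then have "st k x \<bullet> st k x = 0" using st[of k "st k x" x] by simp
    then show ?thesis by simp
  qed
  from this[OF br_closed[OF k y]] have "br k y \<bullet> br k y = 0" by (simp add: st)
  then show ?thesis by simp
qed

text \<open>The component \<open>k\<close> of \<open>st A A\<close> orthogonal to all brackets is
  central, so \<open>k \<bullet> st A A = br A k \<bullet> A = 0\<close>. This makes the trace of
  \<open>br (st A A)\<close> on any ideal vanish.\<close>

lemma st_self_in_derived:
  assumes A: "A \<in> g"
  shows "st A A \<in> span {br x y | x y. x \<in> g \<and> y \<in> g}" (is "_ \<in> span ?S")
proof -
  obtain s k where sk: "s \<in> span ?S" "\<And>w. w \<in> span ?S \<Longrightarrow> orthogonal k w" "st A A = s + k"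
    using orthogonal_subspace_decomp_exists[of ?S "st A A"] by blast
  have "s \<in> g" using sk(1) span_minimal[of ?S g] g br_closed by auto
  then have "k \<in> g" using subspace_diff[OF g st_closed[OF A A]] sk(3) by force
  have "br x y \<bullet> k = 0" if "x \<in> g" "y \<in> g" for x y
    using sk(2)[OF span_base[of "br x y" ?S]] that by (auto simp: orthogonal_def inner_commute)
  then have "br k A = 0" using orthogonal_derived_central \<open>k \<in> g\<close> A by blast
  then have "br A k = 0" using skew[of A k] by simp
  then have "k \<bullet> st A A = 0" using st[of A k A] by simp
  moreover have "k \<bullet> s = 0" using sk by (auto simp: orthogonal_def)
  ultimately have "k = 0" using sk(3) by (simp add: inner_add_right)
  with sk show ?thesis by simp
qed

text \<open>With \<open>P\<close> the orthogonal projection onto \<open>I\<close> one has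
  \<open>tr (P [br A, st A]) = \<parallel>(1 - P) (st A) P\<parallel>\<^sup>2\<close>; as \<open>[br A, st A] = - br (st A A)\<close> and \<open>st A A\<close> is a
  sum of brackets, the left side vanishes.\<close>

lemma ideal_st_closed:
  assumes I: "subspace I" "I \<subseteq> g" and ideal: "\<And>x y. x \<in> g \<Longrightarrow> y \<in> I \<Longrightarrow> br x y \<in> I"
    and A: "A \<in> g" and z: "z \<in> I"
  shows "st A z \<in> I"
proof -
  obtain B where B: "B \<subseteq> I" "pairwise orthogonal B" "\<And>x. x \<in> B \<Longrightarrow> norm x = 1"
    "independent B" "span B = I"
    using orthonormal_basis_subspace[OF I(1)] by metis
  have fin: "finite B" using B(4) by (rule finiteI_independent)
  define P where "P u = (\<Sum>f\<in>B. (u \<bullet> f) *\<^sub>R f)" for u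
  have ort: "e \<bullet> f = (if e = f then 1 else 0)" if "e \<in> B" "f \<in> B" for e f
    using B(2,3) that by (auto simp: pairwise_def orthogonal_def dot_square_norm)
  have P_inner: "P u \<bullet> f = u \<bullet> f" if "f \<in> B" for u f
    using that fin by (simp add: P_def inner_sum_left ort if_distrib cong: sum.cong if_cong)
  have P_in: "P u \<in> I" for u
    unfolding P_def using B(1) by (intro subspace_sum[OF I(1)] subspace_scale[OF I(1)]) auto
  have P_id: "P u = u" if "u \<in> I" for u
  proof -
    have d: "u - P u \<in> span B" using that P_in B(5) subspace_diff[OF I(1)] by simp
    have "orthogonal (u - P u) (u - P u)"
      by (rule orthogonal_to_span[OF d]) (simp add: orthogonal_def inner_diff_left P_inner)
    then show ?thesis by (simp add: orthogonal_def)
  qed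
  have bessel: "u \<bullet> u - (\<Sum>f\<in>B. (u \<bullet> f)\<^sup>2) = (u - P u) \<bullet> (u - P u)" for u
  proof -
    have 1: "u \<bullet> P u = (\<Sum>f\<in>B. (u \<bullet> f)\<^sup>2)"
      by (simp add: P_def inner_sum_right power2_eq_square)
    have 2: "P u \<bullet> P u = (\<Sum>f\<in>B. (u \<bullet> f)\<^sup>2)"
      by (subst (2) P_def) (simp add: inner_sum_right P_inner power2_eq_square)
    show ?thesis using 1 2 by (simp add: inner_diff_left inner_diff_right inner_commute[of "P u" u])
  qed
  \<comment> \<open>The trace of \<open>br x\<close> compressed to \<open>I\<close>.\<close>
  define \<phi> where "\<phi> x = (\<Sum>e\<in>B. br x e \<bullet> e)" for x
  have "linear \<phi>"
    unfolding \<phi>_def by (intro linear_compose_sum ballI linear_compose[OF lin_left, of "\<lambda>u. u \<bullet> e" for e, unfolded o_def]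
        bounded_linear.linear bounded_linear_inner_left)
  \<comment> \<open>As \<open>br y\<close> preserves \<open>I\<close>, the trace of the product is a
    matrix trace over \<open>B\<close>, symmetric in \<open>x\<close> and \<open>y\<close>; traces
    of commutators therefore vanish.\<close>
  have \<phi>_prod: "(\<Sum>e\<in>B. br x (br y e) \<bullet> e) = (\<Sum>e\<in>B. \<Sum>f\<in>B. (br y e \<bullet> f) * (br x f \<bullet> e))"
    if "x \<in> g" "y \<in> g" for x y
  proof (rule sum.cong[OF refl])
    fix e assume "e \<in> B"
    then have "br y e \<in> I" using ideal that B(1) by blast
    then have "br x (br y e) = br x (P (br y e))" by (simp add: P_id)
    also have "\<dots> = (\<Sum>f\<in>B. (br y e \<bullet> f) *\<^sub>R br x f)"
      unfolding P_def by (simp add: linear_sum[OF lin_right] linear_scale[OF lin_right])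
    finally show "br x (br y e) \<bullet> e = (\<Sum>f\<in>B. (br y e \<bullet> f) * (br x f \<bullet> e))"
      by (simp add: inner_sum_left)
  qed
  have \<phi>_br: "\<phi> (br x y) = 0" if "x \<in> g" "y \<in> g" for x y
  proof -
    have "\<phi> (br x y) = (\<Sum>e\<in>B. br x (br y e) \<bullet> e) - (\<Sum>e\<in>B. br y (br x e) \<bullet> e)"
      by (simp add: \<phi>_def jacobi inner_diff_left sum_subtractf)
    also have "(\<Sum>e\<in>B. br y (br x e) \<bullet> e) = (\<Sum>e\<in>B. br x (br y e) \<bullet> e)"
      unfolding \<phi>_prod[OF that] \<phi>_prod[OF that(2,1)]
      by (subst sum.swap) (simp add: mult.commute)
    finally show ?thesis by simp
  qed
  have "\<phi> (st A A) = 0"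
    using st_self_in_derived[OF A]
  proof (induction rule: span_induct_alt)
    case base
    then show ?case by (rule linear_0[OF \<open>linear \<phi>\<close>])
  next
    case (step c x y)
    then show ?case
      using \<phi>_br by (auto simp: linear_add[OF \<open>linear \<phi>\<close>] linear_scale[OF \<open>linear \<phi>\<close>])
  qed
  moreover have "\<phi> (st A A) = - (\<Sum>e\<in>B. (st A e - P (st A e)) \<bullet> (st A e - P (st A e)))"
  proof -
    have 1: "br (st A A) e \<bullet> e = br A e \<bullet> br A e - st A e \<bullet> st A e" if "e \<in> B" for e
    proof -
      have e: "e \<in> g" using that B I by auto
      have "br (st A A) e = st A (br A e) - br A (st A e)"
        using st_derivation[OF A A e] by simp
      then show ?thesis by (simp add: inner_diff_left st) (metis inner_commute st)
    qed
    \<comment> \<open>Parseval is exact for \<open>br A e\<close> since it stays in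
      \<open>I\<close>; transposing the matrix over \<open>B\<close> passes to \<open>st A\<close>,
      of which only the part inside \<open>I\<close> is seen.\<close>
    have 2: "(\<Sum>e\<in>B. br A e \<bullet> br A e) = (\<Sum>e\<in>B. \<Sum>f\<in>B. (st A e \<bullet> f)\<^sup>2)"
    proof -
      have "br A e \<bullet> br A e = (\<Sum>f\<in>B. (br A e \<bullet> f)\<^sup>2)" if "e \<in> B" for e
        using bessel[of "br A e"] P_id[of "br A e"] ideal[OF A] that B(1) by auto
      then have "(\<Sum>e\<in>B. br A e \<bullet> br A e) = (\<Sum>e\<in>B. \<Sum>f\<in>B. (br A e \<bullet> f)\<^sup>2)"
        by simp
      also have "\<dots> = (\<Sum>e\<in>B. \<Sum>f\<in>B. (br A f \<bullet> e)\<^sup>2)"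
        by (rule sum.swap)
      moreover have "br A f \<bullet> e = st A e \<bullet> f" for e f
        by (metis st inner_commute)
      ultimately show ?thesis by simp
    qed
    have "\<phi> (st A A) = (\<Sum>e\<in>B. br A e \<bullet> br A e) - (\<Sum>e\<in>B. st A e \<bullet> st A e)"
      unfolding \<phi>_def by (simp add: 1 sum_subtractf)
    also have "\<dots> = - (\<Sum>e\<in>B. st A e \<bullet> st A e - (\<Sum>f\<in>B. (st A e \<bullet> f)\<^sup>2))"
      unfolding 2 by (simp add: sum_subtractf)
    finally show ?thesis by (simp add: bessel)
  qed
  ultimately have "(\<Sum>e\<in>B. (st A e - P (st A e)) \<bullet> (st A e - P (st A e))) = 0" by simp
  then have "\<forall>e\<in>B. st A e = P (st A e)"
    using fin by (simp add: sum_nonneg_eq_0_iff)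
  then have "st A e \<in> I" if "e \<in> B" for e using that P_in by metis
  moreover have "z \<in> span B" using z B(5) by simp
  ultimately show ?thesis
    using linear_subspace_vimage[OF st_linear[of A] I(1)] span_minimal[of B "st A -` I"] by auto
qed

end

section \<open>Nil ideals and the radical\<close>

lemma scaleR_eq_smult: "r *\<^sub>R (x::complex^'n) = complex_of_real r *s x"
  by (simp add: vec_eq_iff) (simp add: scaleR_conv_of_real)

lemma csubspace_imp_subspace: "csubspace S \<Longrightarrow> subspace S"
  by (auto simp: csubspace_def subspace_def scaleR_eq_smult)

lemma csubspace_span:
  assumes "\<And>c v. v \<in> S \<Longrightarrow> c *s v \<in> S"
  shows "csubspace (span S)"
proof -
  have "subspace {x. c *s x \<in> span S}" for c
    by (auto simp: subspace_def span_zero vector_add_ldistrib span_add span_scale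
        vector_smult_assoc scaleR_eq_smult mult.commute[of c])
       (metis scaleR_eq_smult span_scale vector_smult_assoc)
  then have "span S \<subseteq> {x. c *s x \<in> span S}" for c
    using assms by (intro span_minimal) (auto intro: span_base)
  then show ?thesis by (auto simp: csubspace_def span_zero span_add)
qed

text \<open>Complex coefficients can be absorbed into the vectors of \<open>S\<close>. Applied to
  eigenvectors, it brings the spaces \<open>Aneg\<close>, \<open>Azero\<close> and
  \<open>Apos\<close> within reach of real linear algebra.\<close>

lemma cspan_eq_span:
  assumes "\<And>c v. v \<in> S \<Longrightarrow> c *s v \<in> S"
  shows "cspan S = span S"
proof
  show "cspan S \<subseteq> span S"
    using assms by (auto simp: cspan_def intro!: span_sum intro: span_base)
  show "span S \<subseteq> cspan S"
  proof
    fix x assume "x \<in> span S"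
    then obtain t r where "finite t" "t \<subseteq> S" "x = (\<Sum>a\<in>t. r a *\<^sub>R a)"
      by (auto simp: span_explicit)
    then show "x \<in> cspan S"
      by (auto simp: cspan_def scaleR_eq_smult intro!: exI[of _ t] exI[of _ "\<lambda>a. complex_of_real (r a)"])
  qed
qed

lemma csubspace_sum:
  assumes "csubspace I" "csubspace J"
  shows "csubspace {x + y | x y. x \<in> I \<and> y \<in> J}"
  unfolding csubspace_def
proof (intro conjI ballI allI)
  show "0 \<in> {x + y | x y. x \<in> I \<and> y \<in> J}"
    using assms by (force simp: csubspace_def)
next
  fix u v assume "u \<in> {x + y | x y. x \<in> I \<and> y \<in> J}" "v \<in> {x + y | x y. x \<in> I \<and> y \<in> J}"
  then obtain x y x' y' where "x \<in> I" "y \<in> J" "x' \<in> I" "y' \<in> J" "u = x + y" "v = x' + y'"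
    by blast
  then have "u + v = (x + x') + (y + y')" "x + x' \<in> I" "y + y' \<in> J"
    using assms by (auto simp: csubspace_def)
  then show "u + v \<in> {x + y | x y. x \<in> I \<and> y \<in> J}" by blast
next
  fix u c assume "u \<in> {x + y | x y. x \<in> I \<and> y \<in> J}"
  then obtain x y where "x \<in> I" "y \<in> J" "u = x + y" by blast
  then have "c *s u = c *s x + c *s y" "c *s x \<in> I" "c *s y \<in> J"
    using assms by (auto simp: csubspace_def vector_add_ldistrib)
  then show "c *s u \<in> {x + y | x y. x \<in> I \<and> y \<in> J}" by blast
qed

section \<open>Bilinearity of the product\<close>

lemma mult_add_left: "mult sc (x + y) z = mult sc x z + mult sc y z"
  by (simp add: mult_def vec_eq_iff distrib_right sum.distrib)

lemma mult_add_right: "mult sc x (y + z) = mult sc x y + mult sc x z"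
  by (simp add: mult_def vec_eq_iff distrib_left distrib_right sum.distrib)

lemma mult_smult_left: "mult sc (c *s x) y = c *s mult sc x y"
  by (simp add: mult_def vec_eq_iff sum_distrib_left mult.assoc)

lemma mult_smult_right: "mult sc x (c *s y) = c *s mult sc x y"
  by (simp add: mult_def vec_eq_iff sum_distrib_left mult_ac)

lemma linear_mult_left: "linear (\<lambda>x. mult sc x y)"
  by (rule linearI) (simp_all add: mult_add_left mult_smult_left scaleR_eq_smult)

lemma linear_mult_right: "linear (mult sc x)"
  by (rule linearI) (simp_all add: mult_add_right mult_smult_right scaleR_eq_smult)

lemma mult_zero_left [simp]: "mult sc 0 y = 0"
  by (rule linear_0[OF linear_mult_left])

lemma mult_zero_right [simp]: "mult sc x 0 = 0"
  by (rule linear_0[OF linear_mult_right])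

text \<open>Indexed so that no unit is needed: \<open>npow sc x k\<close> is the \<open>(k + 1)\<close>-st power of \<open>x\<close>.\<close>

primrec npow :: "'n::finite bilin \<Rightarrow> complex^'n \<Rightarrow> nat \<Rightarrow> complex^'n" where
  "npow sc x 0 = x"
| "npow sc x (Suc k) = mult sc (npow sc x k) x"

text \<open>An elementwise condition, easier to verify than a uniform bound on products; for
  associative products the two agree in finite dimension.\<close>

definition nil_ideal :: "'n::finite bilin \<Rightarrow> (complex^'n) set \<Rightarrow> bool" where
  "nil_ideal sc I \<longleftrightarrow> alg_ideal sc I \<and> (\<forall>x\<in>I. \<exists>k. npow sc x k = 0)"

lemma lprod_replicate: "lprod sc (replicate (Suc k) x) = npow sc x k"
proof (induction k)
  case (Suc k)
  have "lprod sc (replicate (Suc (Suc k)) x) = lprod sc (x # (replicate k x @ [x]))"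
    by (simp only: replicate_append_same replicate_Suc)
  also have "\<dots> = mult sc (lprod sc (replicate (Suc k) x)) x" by simp
  finally show ?case using Suc by simp
qed simp

text \<open>The vectors \<open>v\<close> with \<open>v t1 ... tk = 0\<close> for all choices of
  \<open>k\<close> factors in \<open>T\<close>, bracketed to the left as in
  \<open>lprod\<close>.\<close>

primrec annih :: "'n::finite bilin \<Rightarrow> (complex^'n) set \<Rightarrow> nat \<Rightarrow> (complex^'n) set" where
  "annih sc T 0 = {0}"
| "annih sc T (Suc k) = {v. \<forall>t\<in>T. mult sc v t \<in> annih sc T k}"

lemma subspace_annih: "subspace (annih sc T k)"
  by (induction k) (auto simp: subspace_def mult_add_left mult_smult_left scaleR_eq_smult)

lemma annih_mono: "annih sc T k \<subseteq> annih sc T (Suc k)"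
  by (induction k) auto

lemma foldl_annih:
  assumes "v \<in> annih sc T (length ts)" "set ts \<subseteq> T"
  shows "foldl (mult sc) v ts = 0"
  using assms by (induction ts arbitrary: v) auto

section \<open>Engel's theorem: nil ideals are nilpotent\<close>

locale assoc_algebra =
  fixes sc :: "'n::finite bilin"
  assumes assoc: "mult sc (mult sc x y) z = mult sc x (mult sc y z)"
begin

lemma npow_add: "mult sc (npow sc u a) (npow sc u b) = npow sc u (Suc (a + b))"
  by (induction b) (simp_all add: assoc[symmetric])

lemma npow_npow: "npow sc (npow sc u k) m = npow sc u (k + m * Suc k)"
proof (induction m)
  case (Suc m)
  then show ?case by (simp add: npow_add) (simp add: algebra_simps)
qed simp

lemma npow_absorb: "w = mult sc w t \<Longrightarrow> w = mult sc w (npow sc t k)"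
  by (induction k) (auto simp: assoc[symmetric])

text \<open>Engel's argument: let \<open>W\<close> be a right submodule of least dimension not contained in \<open>annih sc T k\<close>.
  If \<open>w T\<close> is not contained in it either for some \<open>w \<in> W\<close>, then \<open>w T = W\<close>, hence \<open>w = w t\<close> with \<open>t\<close>
  nilpotent, and \<open>w = 0\<close>.\<close>

lemma annih_strict:
  assumes nil: "nil_ideal sc T" and ne: "annih sc T k \<noteq> UNIV"
  shows "annih sc T k \<subset> annih sc T (Suc k)"
proof (rule ccontr)
  assume "\<not> annih sc T k \<subset> annih sc T (Suc k)"
  then have eq: "annih sc T (Suc k) = annih sc T k" using annih_mono by blast
  have T: "subspace T" "\<And>x y. x \<in> T \<Longrightarrow> mult sc x y \<in> T"
    using nil by (auto simp: nil_ideal_def alg_ideal_def csubspace_imp_subspace)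
  define good where "good W \<longleftrightarrow> subspace W \<and> (\<forall>w\<in>W. \<forall>t\<in>T. mult sc w t \<in> W) \<and>
    \<not> W \<subseteq> annih sc T k" for W
  have "good UNIV" using ne by (auto simp: good_def)
  then obtain W where W: "good W" "\<And>W'. good W' \<Longrightarrow> dim W \<le> dim W'"
    using exists_least_iff[of "\<lambda>d. \<exists>W. good W \<and> dim W = d"] by (metis not_less)
  have "\<not> W \<subseteq> annih sc T (Suc k)" using W(1) eq by (simp add: good_def)
  then obtain w t0 where w: "w \<in> W" "t0 \<in> T" "mult sc w t0 \<notin> annih sc T k" by auto
  let ?wT = "mult sc w ` T"
  have sub: "?wT \<subseteq> W" using W(1) w(1) by (auto simp: good_def)
  \<comment> \<open>It is a right submodule because \<open>(w t) s = w (t s)\<close> with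
    \<open>t s\<close> in \<open>T\<close>, and \<open>mult sc w t0\<close> witnesses that it is
    large enough.\<close>
  have "good ?wT"
    using w T by (auto simp: good_def assoc intro: linear_subspace_image[OF linear_mult_right])
  with W(2) have "?wT = W"
    using subspace_dim_equal[of ?wT W] sub W(1) by (auto simp: good_def)
  with w(1) obtain t where t: "t \<in> T" "w = mult sc w t" by auto
  obtain m where "npow sc t m = 0" using nil t(1) by (auto simp: nil_ideal_def)
  with npow_absorb[OF t(2), of m] have "w = 0" by simp
  with w(3) show False using subspace_0[OF subspace_annih[of sc T k]] by simp
qed

text \<open>The chain \<open>annih sc T k\<close> grows in real dimension at each step until it
  fills the space, so it does so after at most \<open>DIM(complex^'n)\<close> steps.\<close>

lemma nil_ideal_imp_nilpotent:
  assumes nil: "nil_ideal sc T"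
  shows "nilpotent_ideal sc T"
proof -
  have "annih sc T k = UNIV \<or> k \<le> dim (annih sc T k)" for k
  proof (induction k)
    case (Suc k)
    show ?case
    proof (cases "annih sc T k = UNIV")
      case True
      then show ?thesis using annih_mono[of sc T k] by blast
    next
      case False
      then have "dim (annih sc T k) < dim (annih sc T (Suc k))"
        using annih_strict[OF nil False]
        by (intro dim_psubset) (simp only: span_eq_iff[THEN iffD2, OF subspace_annih])
      with Suc False show ?thesis by simp
    qed
  qed simp
  from this[of "DIM(complex^'n)"] have all: "annih sc T (DIM(complex^'n)) = UNIV" (is "annih sc T ?d = _")
  proof
    assume "?d \<le> dim (annih sc T ?d)"
    then have "dim (annih sc T ?d) = ?d"
      using dim_subset_UNIV[of "annih sc T ?d"] by (rule antisym[rotated])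
    then show ?thesis
      using dim_eq_full[of "annih sc T ?d"] subspace_annih by (metis span_eq_iff)
  qed
  \<comment> \<open>One factor more than the dimension: the first is the vector acted upon, the
    others annihilate it.\<close>
  have "lprod sc xs = 0" if xs: "length xs = Suc ?d" "set xs \<subseteq> T" for xs
  proof -
    obtain x ys where "xs = x # ys" "length ys = ?d"
      using xs(1) by (metis length_Suc_conv)
    moreover from this have "foldl (mult sc) x ys = 0"
      using all xs(2) by (intro foldl_annih[of _ _ T]) auto
    ultimately show ?thesis by simp
  qed
  moreover have "1 \<le> Suc ?d" by simp
  ultimately show ?thesis
    using nil unfolding nilpotent_ideal_def nil_ideal_def by blast
qed

lemma nilpotent_ideal_imp_nil:
  assumes "nilpotent_ideal sc I"
  shows "nil_ideal sc I"
proof -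
  obtain k where k: "k \<ge> 1" "\<And>xs. length xs = k \<Longrightarrow> set xs \<subseteq> I \<Longrightarrow> lprod sc xs = 0"
    using assms by (auto simp: nilpotent_ideal_def)
  have "npow sc x (k - 1) = 0" if "x \<in> I" for x
    using k that lprod_replicate[of sc "k - 1" x] by auto
  then show ?thesis using assms by (auto simp: nil_ideal_def nilpotent_ideal_def)
qed

section \<open>Sums of nil ideals and the radical\<close>

lemma npow_add_mod:
  assumes J: "alg_ideal sc J" and j: "j \<in> J"
  shows "\<exists>j'\<in>J. npow sc (x + j) k = npow sc x k + j'"
proof (induction k)
  case 0
  then show ?case using j by auto
next
  case (Suc k)
  then obtain j' where j': "j' \<in> J" "npow sc (x + j) k = npow sc x k + j'" by blast
  have "mult sc (npow sc x k) j + mult sc j' (x + j) \<in> J"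
    using J j j' by (auto simp: alg_ideal_def csubspace_def)
  then show ?case
    unfolding npow.simps j'(2)
    by (intro bexI[of _ "mult sc (npow sc x k) j + mult sc j' (x + j)"])
       (simp_all add: mult_add_left mult_add_right)
qed

text \<open>In the quotient by \<open>J\<close> the elements \<open>x + j\<close> and
  \<open>x\<close> have the same powers, so some power of \<open>x + j\<close> lies in
  \<open>J\<close> and is nilpotent there.\<close>

lemma npow_add_nil:
  assumes J: "nil_ideal sc J" and j: "j \<in> J" and x: "npow sc x k = 0"
  shows "\<exists>m. npow sc (x + j) m = 0"
proof -
  have "npow sc (x + j) k \<in> J"
    using npow_add_mod[of J j x k] J j x by (auto simp: nil_ideal_def)
  then obtain m where "npow sc (npow sc (x + j) k) m = 0"
    using J by (auto simp: nil_ideal_def)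
  then show ?thesis using npow_npow by metis
qed

text \<open>\<open>I\<close> has to be an ideal only modulo \<open>J\<close>. This covers both the
  sum of two nil ideals and the sum of \<open>Apos D\<close> with the radical.\<close>

lemma nil_ideal_sum:
  assumes I: "csubspace I" "\<And>x. x \<in> I \<Longrightarrow> \<exists>k. npow sc x k = 0"
    and IJ: "\<And>x y. x \<in> I \<Longrightarrow> mult sc x y \<in> {x + y | x y. x \<in> I \<and> y \<in> J}"
      "\<And>x y. x \<in> I \<Longrightarrow> mult sc y x \<in> {x + y | x y. x \<in> I \<and> y \<in> J}"
    and J: "nil_ideal sc J"
  shows "nil_ideal sc {x + y | x y. x \<in> I \<and> y \<in> J}" (is "nil_ideal sc ?S")
proof -
  have J': "csubspace J" "\<And>x y. x \<in> J \<Longrightarrow> mult sc x y \<in> J" "\<And>x y. x \<in> J \<Longrightarrow> mult sc y x \<in> J"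
    using J by (auto simp: nil_ideal_def alg_ideal_def)
  have S: "csubspace ?S" by (intro csubspace_sum I J')
  have JS: "J \<subseteq> ?S" using I(1) by (force simp: csubspace_def)
  have "mult sc u z \<in> ?S \<and> mult sc z u \<in> ?S" if u: "u \<in> ?S" for u z
  proof -
    obtain x y where xy: "u = x + y" "x \<in> I" "y \<in> J" using u by blast
    have "mult sc x z \<in> ?S" "mult sc z x \<in> ?S" "mult sc y z \<in> ?S" "mult sc z y \<in> ?S"
      using IJ[OF xy(2)] J'(2,3)[OF xy(3)] JS by blast+
    then show ?thesis using S unfolding xy(1) mult_add_left mult_add_right csubspace_def by blast
  qed
  moreover have "\<exists>k. npow sc u k = 0" if u: "u \<in> ?S" for u
    using u I(2) npow_add_nil[OF J] by blast
  ultimately show ?thesis using S by (simp add: nil_ideal_def alg_ideal_def)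
qed

text \<open>Sums of nil ideals are nil, so their union is an ideal and the largest nil one. As nil
  and nilpotent ideals coincide, it is the object described by \<open>THE\<close>.\<close>

lemma radical_eq: "radical sc = \<Union> {I. nil_ideal sc I}" (is "_ = ?R")
  and nil_ideal_radical: "nil_ideal sc (radical sc)"
proof -
  have zero: "nil_ideal sc {0}"
    by (auto simp: nil_ideal_def alg_ideal_def csubspace_def intro: exI[of _ 0])
  have add: "x + y \<in> ?R" if xy: "x \<in> ?R" "y \<in> ?R" for x y
  proof -
    obtain I J where IJ: "nil_ideal sc I" "x \<in> I" "nil_ideal sc J" "y \<in> J"
      using xy by blast
    have "0 \<in> J" using IJ(3) by (simp add: nil_ideal_def alg_ideal_def csubspace_def)
    then have "I \<subseteq> {x + y | x y. x \<in> I \<and> y \<in> J}" by force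
    moreover have "csubspace I" "\<And>x. x \<in> I \<Longrightarrow> \<exists>k. npow sc x k = 0"
      "\<And>x y. x \<in> I \<Longrightarrow> mult sc x y \<in> I" "\<And>x y. x \<in> I \<Longrightarrow> mult sc y x \<in> I"
      using IJ(1) by (simp_all add: nil_ideal_def alg_ideal_def)
    ultimately have "nil_ideal sc {x + y | x y. x \<in> I \<and> y \<in> J}"
      by (intro nil_ideal_sum IJ(3)) blast+
    then show ?thesis using IJ by blast
  qed
  have R: "nil_ideal sc ?R"
  proof -
    have closed: "c *s x \<in> ?R" "mult sc x y \<in> ?R" "mult sc y x \<in> ?R" and k: "\<exists>k. npow sc x k = 0"
      if "x \<in> ?R" for x y c
    proof -
      from that obtain I where I: "nil_ideal sc I" "x \<in> I" by blast
      then have "c *s x \<in> I" "mult sc x y \<in> I" "mult sc y x \<in> I" and n: "\<exists>k. npow sc x k = 0"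
        by (simp_all add: nil_ideal_def alg_ideal_def csubspace_def)
      with I(1) show "c *s x \<in> ?R" "mult sc x y \<in> ?R" "mult sc y x \<in> ?R" by blast+
      show "\<exists>k. npow sc x k = 0" by (rule n)
    qed
    have "0 \<in> ?R" using zero by blast
    moreover have "alg_ideal sc S" if "0 \<in> S" "\<And>x y. x \<in> S \<Longrightarrow> y \<in> S \<Longrightarrow> x + y \<in> S"
        "\<And>x c. x \<in> S \<Longrightarrow> c *s x \<in> S" "\<And>x y. x \<in> S \<Longrightarrow> mult sc x y \<in> S"
        "\<And>x y. x \<in> S \<Longrightarrow> mult sc y x \<in> S" for S
      using that by (simp add: alg_ideal_def csubspace_def)
    ultimately have "alg_ideal sc ?R" using add closed by presburger
    with k show ?thesis unfolding nil_ideal_def by blast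
  qed
  have "radical sc = ?R"
    unfolding radical_def
  proof (rule the_equality)
    show "nilpotent_ideal sc ?R \<and> (\<forall>J. nilpotent_ideal sc J \<longrightarrow> J \<subseteq> ?R)"
      using nil_ideal_imp_nilpotent[OF R] nilpotent_ideal_imp_nil by blast
    then show "I = ?R"
      if "nilpotent_ideal sc I \<and> (\<forall>J. nilpotent_ideal sc J \<longrightarrow> J \<subseteq> I)" for I
      using that nilpotent_ideal_imp_nil by blast
  qed
  then show "radical sc = ?R" "nil_ideal sc (radical sc)" using R by simp_all
qed

lemma central_nil_in_radical:
  assumes x: "x \<in> center sc" "npow sc x k = 0"
  shows "x \<in> radical sc"
proof -
  have com: "mult sc y x = mult sc x y" for y using x(1) by (simp add: center_def)
  \<comment> \<open>The ideal generated by the central element \<open>x\<close>; without a unit the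
    multiples \<open>a *s x\<close> must be added to \<open>x\<close> times the algebra.\<close>
  define I where "I = {a *s x + mult sc x y | a y. True}"
  have I: "csubspace I"
    unfolding csubspace_def
  proof (intro conjI ballI allI)
    show "0 \<in> I" by (auto simp: I_def intro!: exI[of _ 0])
  next
    fix u v assume "u \<in> I" "v \<in> I"
    then obtain a b y z where "u = a *s x + mult sc x y" "v = b *s x + mult sc x z"
      by (auto simp: I_def)
    then have "u + v = (a + b) *s x + mult sc x (y + z)"
      by (simp add: mult_add_right vector_sadd_rdistrib)
    then show "u + v \<in> I" unfolding I_def by blast
  next
    fix c u assume "u \<in> I"
    then obtain a y where "u = a *s x + mult sc x y" by (auto simp: I_def)
    then have "c *s u = (c * a) *s x + mult sc x (c *s y)"
      by (simp add: mult_smult_right vector_add_ldistrib vector_smult_assoc)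
    then show "c *s u \<in> I" unfolding I_def by blast
  qed
  have "mult sc u z \<in> I \<and> mult sc z u \<in> I" if u: "u \<in> I" for u z
  proof -
    obtain a y where "u = a *s x + mult sc x y" using u by (auto simp: I_def)
    then have "mult sc u z = 0 *s x + mult sc x (a *s z + mult sc y z)"
      "mult sc z u = 0 *s x + mult sc x (a *s z + mult sc z y)"
      by (simp_all add: mult_add_left mult_add_right mult_smult_left mult_smult_right com assoc
          assoc[of z x, symmetric])
    then show ?thesis unfolding I_def by blast
  qed
  moreover have "\<exists>m. npow sc u m = 0" if u: "u \<in> I" for u
  proof -
    obtain a y where u: "u = a *s x + mult sc x y" using u by (auto simp: I_def)
    \<comment> \<open>By centrality every power of \<open>u\<close> is divisible by the same power
      of \<open>x\<close>.\<close>
    have "\<exists>b z. npow sc u m = b *s npow sc x m + mult sc (npow sc x m) z" for m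
    proof (induction m)
      case 0
      then show ?case using u by auto
    next
      case (Suc m)
      then obtain b z where bz: "npow sc u m = b *s npow sc x m + mult sc (npow sc x m) z" by blast
      define P where "P = npow sc x m"
      have "mult sc (mult sc P z) x = mult sc (mult sc P x) z"
        "mult sc (mult sc P z) (mult sc x y) = mult sc (mult sc P x) (mult sc z y)"
        "mult sc P (mult sc x y) = mult sc (mult sc P x) y"
        by (metis assoc com)+
      then have "npow sc u (Suc m) = (b * a) *s npow sc x (Suc m)
          + mult sc (npow sc x (Suc m)) (b *s y + a *s z + mult sc z y)"
        unfolding npow.simps bz P_def[symmetric] unfolding u
        by (simp add: mult_add_left mult_add_right mult_smult_left mult_smult_right
            vector_add_ldistrib vector_smult_assoc mult.commute)
      then show ?case by blast
    qed
    from this[of k] show ?thesis using x(2) by auto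
  qed
  ultimately have "nil_ideal sc I" using I by (simp add: nil_ideal_def alg_ideal_def)
  moreover have "x = 1 *s x + mult sc x 0" by simp
  then have "x \<in> I" unfolding I_def by blast
  ultimately show ?thesis unfolding radical_eq by blast
qed

end

section \<open>Filtration by the eigenvalues of a derivation\<close>

locale filtered_algebra = assoc_algebra +
  fixes f :: "complex^'n \<Rightarrow> complex^'n"
  assumes f_linear: "linear f"
    and leibniz: "f (mult sc x y) = mult sc (f x) y + mult sc x (f y)"
begin

text \<open>A decreasing filtration, multiplicative by the Leibniz rule; it avoids splitting
  elements into homogeneous components.\<close>

definition U :: "real \<Rightarrow> (complex^'n) set" where
  "U t = span {v. \<exists>s\<ge>t. f v = s *\<^sub>R v}"

lemma eigen_mult:
  assumes "f x = r *\<^sub>R x" "f y = s *\<^sub>R y"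
  shows "f (mult sc x y) = (r + s) *\<^sub>R mult sc x y"
  using assms
  by (simp add: leibniz linear_scale[OF linear_mult_left] linear_scale[OF linear_mult_right] scaleR_left_distrib)

lemma mult_U:
  assumes "x \<in> U a" "y \<in> U b"
  shows "mult sc x y \<in> U (a + b)"
proof -
  have U: "subspace (U t)" for t by (simp add: U_def)
  have 1: "mult sc u v \<in> U (a + b)" if u: "s \<ge> a" "f u = s *\<^sub>R u" and v: "v \<in> U b" for u v s
  proof -
    have "U b \<subseteq> mult sc u -` U (a + b)"
      unfolding U_def[of b]
    proof (rule span_minimal)
      show "subspace (mult sc u -` U (a + b))" by (rule linear_subspace_vimage[OF linear_mult_right U])
      show "{v. \<exists>s\<ge>b. f v = s *\<^sub>R v} \<subseteq> mult sc u -` U (a + b)"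
        using eigen_mult[OF u(2)] u(1) by (force simp: U_def intro!: span_base add_mono)
    qed
    with v show ?thesis by auto
  qed
  have "U a \<subseteq> (\<lambda>u. mult sc u y) -` U (a + b)"
    unfolding U_def[of a]
  proof (rule span_minimal)
    show "subspace ((\<lambda>u. mult sc u y) -` U (a + b))" by (rule linear_subspace_vimage[OF linear_mult_left U])
    show "{v. \<exists>s\<ge>a. f v = s *\<^sub>R v} \<subseteq> (\<lambda>u. mult sc u y) -` U (a + b)"
      using 1 assms(2) by auto
  qed
  with assms(1) show ?thesis by auto
qed

lemma npow_U: "x \<in> U a \<Longrightarrow> npow sc x k \<in> U (real (Suc k) * a)"
proof (induction k)
  case (Suc k)
  then show ?case
    using mult_U[of "npow sc x k" "real (Suc k) * a" x a] by (simp add: algebra_simps)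
qed simp

lemma U_eventually_zero: "\<exists>B. \<forall>t>B. U t = {0}"
proof -
  obtain B where B: "norm (f x) \<le> B * norm x" for x
    using linear_bounded[OF f_linear] by blast
  have "v = 0" if "s \<ge> t" "t > B" "f v = s *\<^sub>R v" for t s v
  proof (rule ccontr)
    assume "v \<noteq> 0"
    moreover have "\<bar>s\<bar> * norm v \<le> B * norm v" using B[of v] that(3) by simp
    ultimately show False using that by simp
  qed
  then have "U t \<subseteq> span {0}" if "t > B" for t
    unfolding U_def by (intro span_mono) (use that in blast)
  then show ?thesis using span_zero by (fastforce simp: U_def)
qed

text \<open>The element lies in \<open>U a\<close> for a single \<open>a > 0\<close>, its powers in
  \<open>U ((k + 1) a)\<close>, and these vanish once \<open>(k + 1) a\<close> exceeds the operator
  norm bound on eigenvalues.\<close>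

lemma positive_nil:
  assumes "x \<in> span {v. \<exists>s>0. f v = s *\<^sub>R v}"
  shows "\<exists>k. npow sc x k = 0"
proof -
  have U: "subspace (U t)" for t by (simp add: U_def)
  have mono: "U b \<subseteq> U a" if "a \<le> b" for a b
    unfolding U_def using that by (intro span_mono Collect_mono) (blast intro: order_trans)
  have "span {v. \<exists>s>0. f v = s *\<^sub>R v} \<subseteq> {x. \<exists>a>0. x \<in> U a}"
  proof (rule span_minimal)
    show "{v. \<exists>s>0. f v = s *\<^sub>R v} \<subseteq> {x. \<exists>a>0. x \<in> U a}"
      by (auto simp: U_def intro: span_base)
    have "\<exists>c>0. x + y \<in> U c" if "a > 0" "b > 0" "x \<in> U a" "y \<in> U b" for a b x y
      using that mono[of "min a b" a] mono[of "min a b" b]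
      by (intro exI[of _ "min a b"]) (auto intro: subspace_add[OF U])
    moreover have "\<exists>a>0. 0 \<in> U a" using subspace_0[OF U] by (intro exI[of _ 1]) simp
    ultimately show "subspace {x. \<exists>a>0. x \<in> U a}"
      unfolding subspace_def using subspace_scale[OF U] by blast
  qed
  with assms obtain a where a: "a > 0" "x \<in> U a" by blast
  obtain B where B: "\<And>t. t > B \<Longrightarrow> U t = {0}" using U_eventually_zero by blast
  obtain k where "B < real k * a" using reals_Archimedean3[OF a(1)] by blast
  then have "B < real (Suc k) * a" using a(1) by (simp add: algebra_simps)
  from B[OF this] npow_U[OF a(2), of k] show ?thesis by auto
qed

end

section \<open>The moment map\<close>

lemma adj_nth [simp]: "adj A $ i $ j = cnj (A $ j $ i)"
  by (simp add: adj_def)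

lemma adj_mult: "adj (A ** B) = adj B ** adj A"
  by (simp add: vec_eq_iff matrix_matrix_mult_def mult.commute)

lemma adj_diff: "adj (A - B) = adj A - adj B"
  by (simp add: vec_eq_iff)

lemma inner_complex_vec: "x \<bullet> y = Re (\<Sum>i\<in>UNIV. x $ i * cnj (y $ i))" for x y :: "complex^'n"
  by (simp add: inner_vec_def inner_complex_def)

text \<open>The Euclidean inner product is the real part of the Hermitian one, so the conjugate
  transpose is also the adjoint in the real sense used above.\<close>

lemma adj_inner: "(A *v x) \<bullet> y = x \<bullet> (adj A *v y)"
proof -
  have "(\<Sum>i\<in>UNIV. (A *v x) $ i * cnj (y $ i)) = (\<Sum>i\<in>UNIV. \<Sum>j\<in>UNIV. A $ i $ j * x $ j * cnj (y $ i))"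
    by (simp add: matrix_vector_mult_def sum_distrib_right)
  also have "\<dots> = (\<Sum>j\<in>UNIV. \<Sum>i\<in>UNIV. A $ i $ j * x $ j * cnj (y $ i))"
    by (rule sum.swap)
  also have "\<dots> = (\<Sum>j\<in>UNIV. x $ j * cnj ((adj A *v y) $ j))"
    by (simp add: matrix_vector_mult_def sum_distrib_left mult_ac)
  finally show ?thesis by (simp add: inner_complex_vec)
qed

lemma Lmat_mult: "Lmat sc x *v y = mult sc x y"
  by (simp add: Lmat_def mult_def vec_eq_iff matrix_vector_mult_def sum_distrib_left sum_distrib_right)
     (intro allI, subst sum.swap, simp add: mult_ac)

lemma Rmat_mult: "Rmat sc x *v y = mult sc y x"
  by (simp add: Rmat_def mult_def vec_eq_iff matrix_vector_mult_def sum_distrib_left sum_distrib_right mult_ac)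

lemma ebasis_times: "ebasis i $ k * a = (if k = i then a else 0)"
  by (simp add: ebasis_def axis_def)

lemma Lmat_ebasis [simp]: "Lmat sc (ebasis i) $ k $ j = sc i j k"
  by (simp add: Lmat_def ebasis_times)

lemma Rmat_ebasis [simp]: "Rmat sc (ebasis j) $ k $ i = sc i j k"
  by (simp add: Rmat_def ebasis_times)

lemma mult_ebasis: "mult sc (ebasis i) (ebasis j) $ k = sc i j k"
  by (simp only: mult_def vec_lambda_beta mult.assoc sum_distrib_left[symmetric]) (simp add: ebasis_times)

text \<open>The derivative of the change-of-basis action
  \<open>g \<mu>(g\<inverse> x, g\<inverse> y)\<close> in structure constants;
  \<open>mult_act\<close> is its coordinate-free form.\<close>

definition act :: "complex^'n^'n \<Rightarrow> 'n::finite bilin \<Rightarrow> 'n bilin" where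
  "act E f i j k = (\<Sum>l\<in>UNIV. E $ k $ l * f i j l) - (\<Sum>l\<in>UNIV. E $ l $ i * f l j k)
    - (\<Sum>l\<in>UNIV. E $ l $ j * f i l k)"

definition hip :: "'n::finite bilin \<Rightarrow> 'n bilin \<Rightarrow> complex" where
  "hip f g = (\<Sum>i\<in>UNIV. \<Sum>j\<in>UNIV. \<Sum>k\<in>UNIV. f i j k * cnj (g i j k))"

lemma mult_act: "mult (act E f) x y = E *v mult f x y - mult f (E *v x) y - mult f x (E *v y)"
proof -
  have "(\<Sum>i\<in>UNIV. \<Sum>j\<in>UNIV. x $ i * y $ j * (\<Sum>l\<in>UNIV. E $ k $ l * f i j l)) = (E *v mult f x y) $ k" for k
  proof -
    have "(\<Sum>i\<in>UNIV. \<Sum>j\<in>UNIV. x $ i * y $ j * (\<Sum>l\<in>UNIV. E $ k $ l * f i j l))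
      = (\<Sum>i\<in>UNIV. \<Sum>j\<in>UNIV. \<Sum>l\<in>UNIV. E $ k $ l * (x $ i * y $ j * f i j l))"
      by (simp add: sum_distrib_left mult_ac)
    also have "\<dots> = (\<Sum>i\<in>UNIV. \<Sum>l\<in>UNIV. \<Sum>j\<in>UNIV. E $ k $ l * (x $ i * y $ j * f i j l))"
      by (rule sum.cong[OF refl], rule sum.swap)
    also have "\<dots> = (\<Sum>l\<in>UNIV. \<Sum>i\<in>UNIV. \<Sum>j\<in>UNIV. E $ k $ l * (x $ i * y $ j * f i j l))"
      by (rule sum.swap)
    finally show ?thesis
      by (simp add: matrix_vector_mult_def mult_def sum_distrib_left)
  qed
  moreover have "(\<Sum>i\<in>UNIV. \<Sum>j\<in>UNIV. x $ i * y $ j * (\<Sum>l\<in>UNIV. E $ l $ i * f l j k)) = mult f (E *v x) y $ k" for k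
  proof -
    have "(\<Sum>i\<in>UNIV. \<Sum>j\<in>UNIV. x $ i * y $ j * (\<Sum>l\<in>UNIV. E $ l $ i * f l j k))
      = (\<Sum>i\<in>UNIV. \<Sum>j\<in>UNIV. \<Sum>l\<in>UNIV. E $ l $ i * x $ i * (y $ j * f l j k))"
      by (simp add: sum_distrib_left mult_ac)
    also have "\<dots> = (\<Sum>i\<in>UNIV. \<Sum>l\<in>UNIV. \<Sum>j\<in>UNIV. E $ l $ i * x $ i * (y $ j * f l j k))"
      by (rule sum.cong[OF refl], rule sum.swap)
    also have "\<dots> = (\<Sum>l\<in>UNIV. \<Sum>i\<in>UNIV. \<Sum>j\<in>UNIV. E $ l $ i * x $ i * (y $ j * f l j k))"
      by (rule sum.swap)
    also have "\<dots> = (\<Sum>l\<in>UNIV. \<Sum>j\<in>UNIV. \<Sum>i\<in>UNIV. E $ l $ i * x $ i * (y $ j * f l j k))"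
      by (rule sum.cong[OF refl], rule sum.swap)
    finally show ?thesis
      by (simp add: matrix_vector_mult_def mult_def sum_distrib_right mult.assoc)
  qed
  moreover have "(\<Sum>i\<in>UNIV. \<Sum>j\<in>UNIV. x $ i * y $ j * (\<Sum>l\<in>UNIV. E $ l $ j * f i l k)) = mult f x (E *v y) $ k" for k
  proof -
    have "(\<Sum>i\<in>UNIV. \<Sum>j\<in>UNIV. x $ i * y $ j * (\<Sum>l\<in>UNIV. E $ l $ j * f i l k))
      = (\<Sum>i\<in>UNIV. \<Sum>j\<in>UNIV. \<Sum>l\<in>UNIV. x $ i * (E $ l $ j * y $ j) * f i l k)"
      by (simp add: sum_distrib_left mult_ac)
    also have "\<dots> = (\<Sum>i\<in>UNIV. \<Sum>l\<in>UNIV. \<Sum>j\<in>UNIV. x $ i * (E $ l $ j * y $ j) * f i l k)"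
      by (rule sum.cong[OF refl], rule sum.swap)
    finally show ?thesis
      by (simp add: matrix_vector_mult_def mult_def sum_distrib_left sum_distrib_right mult_ac)
  qed
  ultimately show ?thesis
    by (simp add: vec_eq_iff mult_def[of "act E f"] act_def right_diff_distrib sum_subtractf)
qed

lemma bilin_eqI: "(\<And>x y. mult f x y = mult g x y) \<Longrightarrow> f = g"
  by (intro ext) (metis mult_ebasis)

lemma mult_zero_bilin: "mult (\<lambda>_ _ _. 0) x y = 0"
  by (simp add: mult_def vec_eq_iff)

lemma derivation_iff_act: "derivation sc A \<longleftrightarrow> act A sc = (\<lambda>_ _ _. 0)"
proof
  assume "derivation sc A"
  then show "act A sc = (\<lambda>_ _ _. 0)"
    by (intro bilin_eqI) (simp add: mult_act mult_zero_bilin derivation_def)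
next
  assume 0: "act A sc = (\<lambda>_ _ _. 0)"
  show "derivation sc A"
    unfolding derivation_def
    using mult_act[of A sc] unfolding 0 mult_zero_bilin by (simp add: diff_eq_eq)
qed

lemma mult_diff_left: "mult sc (x - y) z = mult sc x z - mult sc y z"
  by (rule linear_diff[OF linear_mult_left])

lemma mult_diff_right: "mult sc x (y - z) = mult sc x y - mult sc x z"
  by (rule linear_diff[OF linear_mult_right])

text \<open>\<open>act\<close> respects commutators, and the term \<open>act B (act A sc)\<close>
  vanishes for a derivation \<open>A\<close>.\<close>

lemma act_commutator_derivation:
  assumes "derivation sc A"
  shows "act (A ** B - B ** A) sc = act A (act B sc)"
  using assms unfolding derivation_def
  by (intro bilin_eqI)
     (simp add: mult_act matrix_vector_mult_diff_rdistrib matrix_vector_mul_assoc[symmetric]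
       matrix_vector_mult_diff_distrib matrix_vector_right_distrib mult_diff_left mult_diff_right
       mult_add_left mult_add_right)

lemma hip_self: "hip f f = complex_of_real (\<Sum>i\<in>UNIV. \<Sum>j\<in>UNIV. \<Sum>k\<in>UNIV. (cmod (f i j k))\<^sup>2)"
  by (simp add: hip_def complex_norm_square del: of_real_power)

lemma Re_hip_self_nonneg: "Re (hip f f) \<ge> 0"
  by (simp add: hip_self sum_nonneg)

lemma Re_hip_self_eq_0: "Re (hip f f) = 0 \<longleftrightarrow> f = (\<lambda>_ _ _. 0)"
  by (simp add: hip_self sum_nonneg_eq_0_iff sum_nonneg fun_eq_iff)

lemma hip_act_adj: "hip (act A f) g = hip f (act (adj A) g)"
proof -
  have 1: "(\<Sum>k\<in>UNIV. (\<Sum>l\<in>UNIV. A $ k $ l * f i j l) * cnj (g i j k))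
      = (\<Sum>k\<in>UNIV. f i j k * cnj (\<Sum>l\<in>UNIV. adj A $ k $ l * g i j l))" for i j
  proof -
    have "(\<Sum>k\<in>UNIV. (\<Sum>l\<in>UNIV. A $ k $ l * f i j l) * cnj (g i j k))
        = (\<Sum>k\<in>UNIV. \<Sum>l\<in>UNIV. A $ k $ l * f i j l * cnj (g i j k))"
      by (simp add: sum_distrib_right)
    also have "\<dots> = (\<Sum>l\<in>UNIV. \<Sum>k\<in>UNIV. A $ k $ l * f i j l * cnj (g i j k))" by (rule sum.swap)
    finally show ?thesis by (simp add: sum_distrib_left mult_ac)
  qed
  have 2: "(\<Sum>i\<in>UNIV. (\<Sum>l\<in>UNIV. A $ l $ i * F l) * cnj (G i))
      = (\<Sum>i\<in>UNIV. F i * cnj (\<Sum>l\<in>UNIV. adj A $ l $ i * G l))" for F G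
  proof -
    have "(\<Sum>i\<in>UNIV. (\<Sum>l\<in>UNIV. A $ l $ i * F l) * cnj (G i))
        = (\<Sum>i\<in>UNIV. \<Sum>l\<in>UNIV. A $ l $ i * F l * cnj (G i))"
      by (simp add: sum_distrib_right)
    also have "\<dots> = (\<Sum>l\<in>UNIV. \<Sum>i\<in>UNIV. A $ l $ i * F l * cnj (G i))" by (rule sum.swap)
    finally show ?thesis by (simp add: sum_distrib_left mult_ac)
  qed
  \<comment> \<open>For either input slot, the index on which \<open>A\<close> acts is moved
    innermost so that \<open>2\<close> applies.\<close>
  have swap: "(\<Sum>i\<in>UNIV. \<Sum>j\<in>UNIV. \<Sum>k\<in>UNIV. H i j k) = (\<Sum>j\<in>UNIV. \<Sum>k\<in>UNIV. \<Sum>i\<in>UNIV. H i j k)"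
    for H :: "'a \<Rightarrow> 'a \<Rightarrow> 'a \<Rightarrow> complex"
    by (subst sum.swap) (rule sum.cong[OF refl], rule sum.swap)
  have swap': "(\<Sum>i\<in>UNIV. \<Sum>j\<in>UNIV. \<Sum>k\<in>UNIV. H i j k) = (\<Sum>i\<in>UNIV. \<Sum>k\<in>UNIV. \<Sum>j\<in>UNIV. H i j k)"
    for H :: "'a \<Rightarrow> 'a \<Rightarrow> 'a \<Rightarrow> complex"
    by (rule sum.cong[OF refl], rule sum.swap)
  have "(\<Sum>i\<in>UNIV. \<Sum>j\<in>UNIV. \<Sum>k\<in>UNIV. (\<Sum>l\<in>UNIV. A $ l $ i * f l j k) * cnj (g i j k))
      = (\<Sum>i\<in>UNIV. \<Sum>j\<in>UNIV. \<Sum>k\<in>UNIV. f i j k * cnj (\<Sum>l\<in>UNIV. adj A $ l $ i * g l j k))"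
    by (rule trans[OF swap], rule trans[OF _ swap[symmetric]]) (simp only: 2)
  moreover have "(\<Sum>i\<in>UNIV. \<Sum>j\<in>UNIV. \<Sum>k\<in>UNIV. (\<Sum>l\<in>UNIV. A $ l $ j * f i l k) * cnj (g i j k))
      = (\<Sum>i\<in>UNIV. \<Sum>j\<in>UNIV. \<Sum>k\<in>UNIV. f i j k * cnj (\<Sum>l\<in>UNIV. adj A $ l $ j * g i l k))"
    by (rule trans[OF swap'], rule trans[OF _ swap'[symmetric]]) (simp only: 2)
  ultimately show ?thesis
    unfolding hip_def act_def
    by (simp only: left_diff_distrib complex_cnj_diff right_diff_distrib sum_subtractf 1)
qed

section \<open>The trace form of the moment map\<close>

lemma Mmu_nth: "Mmu sc $ k $ l = 2 * ((\<Sum>i\<in>UNIV. \<Sum>j\<in>UNIV. sc i j k * cnj (sc i j l))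
    - (\<Sum>i\<in>UNIV. \<Sum>j\<in>UNIV. cnj (sc i k j) * sc i l j) - (\<Sum>i\<in>UNIV. \<Sum>j\<in>UNIV. cnj (sc k i j) * sc l i j))"
  by (simp add: Mmu_def matrix_matrix_mult_def scaleR_conv_of_real right_diff_distrib)

lemma adj_Mmu: "adj (Mmu sc) = Mmu sc"
  by (simp add: vec_eq_iff Mmu_nth mult.commute)

lemma trace_Mmu: "trace (Mmu sc ** E) = 2 * hip (act E sc) sc"
proof -
  \<comment> \<open>Each reordering puts innermost the index that \<open>act\<close> contracts:
    \<open>r1\<close> for the output slot, \<open>r2\<close> and \<open>r3\<close> for the second
    and first input slots.\<close>
  have r1: "(\<Sum>k\<in>UNIV. \<Sum>l\<in>UNIV. \<Sum>i\<in>UNIV. \<Sum>j\<in>UNIV. F k l i j) = (\<Sum>i\<in>UNIV. \<Sum>j\<in>UNIV. \<Sum>l\<in>UNIV. \<Sum>k\<in>UNIV. F k l i j)"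
    and r2: "(\<Sum>k\<in>UNIV. \<Sum>l\<in>UNIV. \<Sum>i\<in>UNIV. \<Sum>j\<in>UNIV. F k l i j) = (\<Sum>i\<in>UNIV. \<Sum>k\<in>UNIV. \<Sum>j\<in>UNIV. \<Sum>l\<in>UNIV. F k l i j)"
    and r3: "(\<Sum>k\<in>UNIV. \<Sum>l\<in>UNIV. \<Sum>i\<in>UNIV. \<Sum>j\<in>UNIV. F k l i j) = (\<Sum>k\<in>UNIV. \<Sum>i\<in>UNIV. \<Sum>j\<in>UNIV. \<Sum>l\<in>UNIV. F k l i j)"
    for F :: "'a \<Rightarrow> 'a \<Rightarrow> 'a \<Rightarrow> 'a \<Rightarrow> complex"
    unfolding sum.cartesian_product
    by (rule sum.reindex_bij_witness[of _ "\<lambda>(i,j,l,k). (k,l,i,j)" "\<lambda>(k,l,i,j). (i,j,l,k)"]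
        sum.reindex_bij_witness[of _ "\<lambda>(i,k,j,l). (k,l,i,j)" "\<lambda>(k,l,i,j). (i,k,j,l)"]
        sum.reindex_bij_witness[of _ "\<lambda>(k,i,j,l). (k,l,i,j)" "\<lambda>(k,l,i,j). (k,i,j,l)"];
        force)+
  have "trace (Mmu sc ** E) = 2 *
     ((\<Sum>k\<in>UNIV. \<Sum>l\<in>UNIV. \<Sum>i\<in>UNIV. \<Sum>j\<in>UNIV. E $ l $ k * sc i j k * cnj (sc i j l))
    - (\<Sum>k\<in>UNIV. \<Sum>l\<in>UNIV. \<Sum>i\<in>UNIV. \<Sum>j\<in>UNIV. E $ l $ k * sc i l j * cnj (sc i k j))
    - (\<Sum>k\<in>UNIV. \<Sum>l\<in>UNIV. \<Sum>i\<in>UNIV. \<Sum>j\<in>UNIV. E $ l $ k * sc l i j * cnj (sc k i j)))"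
    by (simp add: trace_def matrix_matrix_mult_def Mmu_nth left_diff_distrib sum_subtractf
        sum_distrib_left sum_distrib_right right_diff_distrib mult_ac)
  also have "\<dots> = 2 * hip (act E sc) sc"
    unfolding r1[of "\<lambda>k l i j. E $ l $ k * sc i j k * cnj (sc i j l)"]
      r2[of "\<lambda>k l i j. E $ l $ k * sc i l j * cnj (sc i k j)"]
      r3[of "\<lambda>k l i j. E $ l $ k * sc l i j * cnj (sc k i j)"]
    by (simp add: hip_def act_def left_diff_distrib sum_subtractf sum_distrib_right)
  finally show ?thesis .
qed

lemma trace_mult_adj: "trace (A ** adj A) = complex_of_real (\<Sum>i\<in>UNIV. \<Sum>j\<in>UNIV. (cmod (A $ i $ j))\<^sup>2)"
  by (simp add: trace_def matrix_matrix_mult_def complex_norm_square del: of_real_power)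

lemma Re_trace_mult_adj_nonneg: "Re (trace (A ** adj A)) \<ge> 0"
  by (simp add: trace_mult_adj sum_nonneg)

lemma Re_trace_mult_adj_eq_0: "Re (trace (A ** adj A)) = 0 \<longleftrightarrow> A = 0"
  by (simp add: trace_mult_adj sum_nonneg_eq_0_iff sum_nonneg vec_eq_iff)

lemma trace_scaleR: "trace (r *\<^sub>R (A::complex^'n^'n)) = r *\<^sub>R trace A"
  by (simp add: trace_def scaleR_sum_right)

lemma scaleR_matrix_vector: "(r *\<^sub>R (A::complex^'n^'m)) *v x = r *\<^sub>R (A *v x)"
  by (simp add: vec_eq_iff matrix_vector_mult_def scaleR_sum_right)

lemma matrix_add_distrib_right: "((A::'a::ring_1^'n^'m) + B) ** C = A ** C + B ** C"
  by (simp add: vec_eq_iff matrix_matrix_mult_def distrib_right sum.distrib)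

lemma matrix_diff_distrib_left: "(A::'a::ring_1^'n^'m) ** (B - C) = A ** B - A ** C"
  by (simp add: vec_eq_iff matrix_matrix_mult_def right_diff_distrib sum_subtractf)

lemma matrix_diff_distrib_right: "((A::'a::ring_1^'n^'m) - B) ** C = A ** C - B ** C"
  by (simp add: vec_eq_iff matrix_matrix_mult_def left_diff_distrib sum_subtractf)

section \<open>Consequences of the critical point equation\<close>

locale critical_algebra = assoc_algebra sc for sc :: "'n::finite bilin" +
  fixes c :: real and D :: "complex^'n^'n"
  assumes nonzero: "sc \<noteq> (\<lambda>_ _ _. 0)"
    and crit: "Mmu sc = c *\<^sub>R mat 1 + D"
    and der: "derivation sc D"
begin

lemma adj_D: "adj D = D"
proof -
  have "D = Mmu sc - c *\<^sub>R mat 1" by (simp add: crit)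
  moreover have "adj (c *\<^sub>R (mat 1 :: complex^'n^'n)) = c *\<^sub>R mat 1"
    by (simp add: vec_eq_iff mat_def)
  ultimately show ?thesis by (metis adj_diff adj_Mmu)
qed

lemma c_negative: "c < 0"
proof -
  \<comment> \<open>The identity contributes once from the output and minus once from each of the
    two inputs.\<close>
  have act1: "act (mat 1) sc = (\<lambda>i j k. - sc i j k)"
    by (intro bilin_eqI) (simp add: mult_act, simp add: mult_def vec_eq_iff sum_negf)
  have M1: "trace (Mmu sc) = - 2 * hip sc sc"
    using trace_Mmu[of sc "mat 1"] unfolding act1 by (simp add: hip_def sum_negf)
  have D0: "trace (Mmu sc ** D) = 0"
    using der by (simp add: trace_Mmu derivation_iff_act hip_def)
  have "trace (Mmu sc ** adj (Mmu sc)) = trace ((c *\<^sub>R mat 1 + D) ** Mmu sc)"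
    by (simp only: adj_Mmu crit[symmetric])
  also have "\<dots> = c *\<^sub>R trace (Mmu sc)"
    using D0 trace_mul_sym[of D "Mmu sc"]
    by (simp add: matrix_add_distrib_right trace_add scalar_matrix_assoc[symmetric] trace_scaleR)
  finally have eq: "Re (trace (Mmu sc ** adj (Mmu sc))) = - 2 * c * Re (hip sc sc)"
    by (simp add: M1)
  have pos: "Re (hip sc sc) > 0"
    using Re_hip_self_nonneg[of sc] Re_hip_self_eq_0[of sc] nonzero by linarith
  have "Mmu sc \<noteq> 0"
    using M1 pos by (auto simp: trace_def)
  then have "Re (trace (Mmu sc ** adj (Mmu sc))) > 0"
    using Re_trace_mult_adj_nonneg[of "Mmu sc"] Re_trace_mult_adj_eq_0[of "Mmu sc"] by linarith
  with eq pos show ?thesis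
    by (simp add: mult_less_0_iff)
qed

text \<open>Evaluate \<open>tr (M [A, A\<^sup>*])\<close> in two ways: through the action it is
  \<open>2 \<parallel>act A\<^sup>* sc\<parallel>\<^sup>2\<close>, through \<open>M = c I + D\<close> it is \<open>tr ([D, A] A\<^sup>*)\<close>.\<close>

lemma derivation_weight:
  assumes A: "derivation sc A" and w: "D ** A - A ** D = r *\<^sub>R A"
  shows "r * Re (trace (A ** adj A)) = 2 * Re (hip (act (adj A) sc) (act (adj A) sc))"
proof -
  let ?E = "A ** adj A - adj A ** A"
  have "trace (Mmu sc ** ?E) = 2 * hip (act (adj A) sc) (act (adj A) sc)"
    by (simp add: trace_Mmu act_commutator_derivation[OF A] hip_act_adj)
  moreover have "trace (Mmu sc ** ?E) = r *\<^sub>R trace (A ** adj A)"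
  proof -
    have "trace ?E = 0" by (simp add: trace_sub trace_mul_sym[of A])
    then have "trace (Mmu sc ** ?E) = trace (D ** ?E)"
      by (simp add: crit matrix_add_distrib_right trace_add scalar_matrix_assoc[symmetric] trace_scaleR)
    also have "\<dots> = trace (D ** A ** adj A) - trace (D ** adj A ** A)"
      by (simp add: matrix_diff_distrib_left trace_sub matrix_mul_assoc)
    also have "trace (D ** adj A ** A) = trace (A ** D ** adj A)"
      using trace_mul_sym[of "D ** adj A" A] by (simp add: matrix_mul_assoc)
    also have "trace (D ** A ** adj A) - trace (A ** D ** adj A) = trace ((r *\<^sub>R A) ** adj A)"
      unfolding w[symmetric] by (simp add: matrix_diff_distrib_right trace_sub)
    finally show ?thesis by (simp add: scalar_matrix_assoc[symmetric] trace_scaleR)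
  qed
  ultimately have "Re (r *\<^sub>R trace (A ** adj A)) = Re (2 * hip (act (adj A) sc) (act (adj A) sc))"
    by simp
  then show ?thesis by simp
qed

definition ad :: "complex^'n \<Rightarrow> complex^'n^'n" where
  "ad x = Lmat sc x - Rmat sc x"

lemma ad_vec: "ad x *v y = commutator sc x y"
  by (simp add: ad_def matrix_vector_mult_diff_rdistrib Lmat_mult Rmat_mult commutator_def)

lemma derivation_ad: "derivation sc (ad x)"
  by (simp add: derivation_def ad_vec commutator_def mult_diff_left mult_diff_right assoc)

text \<open>Since \<open>D\<close> is a derivation, its commutator with \<open>ad x\<close> is
  \<open>ad (D *v x)\<close>.\<close>

lemma ad_weight:
  assumes "D *v x = r *\<^sub>R x"
  shows "D ** ad x - ad x ** D = r *\<^sub>R ad x"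
proof -
  have "(D ** ad x - ad x ** D) *v y = (r *\<^sub>R ad x) *v y" for y
  proof -
    have "(D ** ad x - ad x ** D) *v y = D *v commutator sc x y - commutator sc x (D *v y)"
      by (simp add: matrix_vector_mult_diff_rdistrib matrix_vector_mul_assoc[symmetric] ad_vec)
    also have "\<dots> = commutator sc (D *v x) y"
      using der by (simp add: commutator_def matrix_vector_mult_diff_distrib derivation_def)
    also have "\<dots> = r *\<^sub>R commutator sc x y"
      by (simp add: assms commutator_def linear_scale[OF linear_mult_left]
          linear_scale[OF linear_mult_right] scaleR_right_diff_distrib)
    finally show ?thesis by (simp add: ad_vec[symmetric] scaleR_matrix_vector)
  qed
  then show ?thesis by (metis matrix_eq)
qed

lemma negative_eigenvector_central:
  assumes "D *v x = r *\<^sub>R x" "r < 0"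
  shows "x \<in> center sc"
proof -
  have "r * Re (trace (ad x ** adj (ad x))) \<ge> 0"
    using derivation_weight[OF derivation_ad ad_weight[OF assms(1)]]
      Re_hip_self_nonneg[of "act (adj (ad x)) sc"] by simp
  then have "ad x = 0"
    using assms(2) Re_trace_mult_adj_nonneg[of "ad x"] Re_trace_mult_adj_eq_0[of "ad x"]
    by (simp add: zero_le_mult_iff)
  then have "commutator sc x y = 0" for y by (simp add: ad_vec[symmetric])
  then show ?thesis by (simp add: center_def commutator_def)
qed

lemma derivation_adj_ad:
  assumes "D *v x = 0"
  shows "derivation sc (adj (ad x))"
  using derivation_weight[OF derivation_ad ad_weight[of x 0]] assms
  by (simp add: derivation_iff_act Re_hip_self_eq_0)

lemma ann_eigenvalue_positive:
  assumes x: "x \<in> ann sc" "x \<noteq> 0" and r: "D *v x = r *\<^sub>R x"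
  shows "r > 0"
proof -
  \<comment> \<open>All terms of \<open>Mmu sc\<close> ending in \<open>Lmat\<close> or
    \<open>Rmat\<close> kill \<open>x\<close>; only the nonnegative sum of the \<open>L L*\<close>
    terms survives.\<close>
  have LR: "Lmat sc y *v x = 0" "Rmat sc y *v x = 0" for y
    using x(1) by (simp_all add: Lmat_mult Rmat_mult ann_def)
  have "(Mmu sc *v x) \<bullet> x = 2 * (\<Sum>i\<in>UNIV. ((Lmat sc (ebasis i) ** adj (Lmat sc (ebasis i))) *v x) \<bullet> x)"
  proof -
    have s: "(\<Sum>i\<in>UNIV. F i) *v x = (\<Sum>i\<in>UNIV. F i *v x)" for F :: "'n \<Rightarrow> complex^'n^'n"
      by (induction rule: infinite_finite_induct) (simp_all add: matrix_vector_mult_add_rdistrib)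
    show ?thesis
      by (simp add: Mmu_def matrix_vector_mult_diff_rdistrib scaleR_matrix_vector s
          matrix_vector_mul_assoc[symmetric] LR inner_sum_left)
  qed
  also have "\<dots> \<ge> 0"
  proof -
    have "((A ** adj A) *v x) \<bullet> x = (adj A *v x) \<bullet> (adj A *v x)" for A :: "complex^'n^'n"
      by (simp only: matrix_vector_mul_assoc[symmetric] adj_inner[of A "adj A *v x"])
    then show ?thesis by (simp add: sum_nonneg)
  qed
  finally have "0 \<le> (Mmu sc *v x) \<bullet> x" .
  also have "Mmu sc *v x = (c + r) *\<^sub>R x"
    by (simp add: crit matrix_vector_mult_add_rdistrib scaleR_matrix_vector r scaleR_left_distrib)
  finally have "0 \<le> (c + r) * (x \<bullet> x)" by simp
  then have "0 \<le> c + r" using x(2) by (metis inner_gt_zero_iff mult_neg_pos not_le)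
  then show ?thesis using c_negative by simp
qed

end

section \<open>The eigenspace decomposition\<close>

lemma matrix_vector_smult: "A *v (c *s x) = c *s (A *v x)" for A :: "complex^'n^'m"
  by (simp add: vec_eq_iff matrix_vector_mult_def sum_distrib_left mult_ac)

lemma linear_matrix_vector: "linear ((*v) (A :: complex^'n^'m))"
  by (rule linearI) (simp_all add: matrix_vector_right_distrib scaleR_eq_smult matrix_vector_smult)

lemma eigen_smult:
  fixes A :: "complex^'n^'n"
  shows "A *v v = r *\<^sub>R v \<Longrightarrow> A *v (k *s v) = r *\<^sub>R (k *s v)"
  by (simp add: matrix_vector_smult scaleR_eq_smult vector_smult_assoc mult.commute)

lemma Aneg_eq: "Aneg D = span {v. \<exists>r<0. D *v v = r *\<^sub>R v}" "csubspace (Aneg D)"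
proof -
  show "Aneg D = span {v. \<exists>r<0. D *v v = r *\<^sub>R v}"
    unfolding Aneg_def scaleR_eq_smult[symmetric]
    by (rule cspan_eq_span) (auto intro: eigen_smult)
  then show "csubspace (Aneg D)" by (auto intro!: csubspace_span intro: eigen_smult)
qed

lemma Apos_eq: "Apos D = span {v. \<exists>r>0. D *v v = r *\<^sub>R v}" "csubspace (Apos D)"
proof -
  show "Apos D = span {v. \<exists>r>0. D *v v = r *\<^sub>R v}"
    unfolding Apos_def scaleR_eq_smult[symmetric]
    by (rule cspan_eq_span) (auto intro: eigen_smult)
  then show "csubspace (Apos D)" by (auto intro!: csubspace_span intro: eigen_smult)
qed

lemma Azero_eq: "Azero D = {v. D *v v = 0}"
proof -
  have "Azero D = span {v. D *v v = 0}"
    unfolding Azero_def by (subst cspan_eq_span) (auto simp: matrix_vector_smult)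
  also have "\<dots> = {v. D *v v = 0}"
    using linear_subspace_vimage[OF linear_matrix_vector[of D] subspace_single_0]
    by (simp add: span_eq_iff vimage_def)
  finally show ?thesis .
qed

section \<open>Eigenspaces against annihilator, center and radical; the Lie algebra on the kernel of
  \<open>D\<close>\<close>

context critical_algebra
begin

lemma D_sym: "(D *v x) \<bullet> y = x \<bullet> (D *v y)"
  using adj_inner[of D x y] by (simp add: adj_D)

lemma D_leibniz: "D *v mult sc x y = mult sc (D *v x) y + mult sc x (D *v y)"
  using der by (simp add: derivation_def)

lemma eigenvectors_span: "span {v. \<exists>r. D *v v = r *\<^sub>R v} = UNIV"
  using selfadjoint_span_eigenvectors[OF linear_matrix_vector D_sym subspace_UNIV] by auto

text \<open>The annihilator is invariant under the derivation \<open>D\<close>, hence spanned by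
  eigenvectors of \<open>D\<close> lying in it.\<close>

lemma ann_subset_Apos: "ann sc \<subseteq> Apos D"
proof -
  have "subspace (ann sc)"
    by (auto simp: ann_def subspace_def mult_add_left mult_add_right scaleR_eq_smult
        mult_smult_left mult_smult_right)
  moreover have "(*v) D ` ann sc \<subseteq> ann sc"
  proof -
    have "mult sc (D *v x) y = 0 \<and> mult sc y (D *v x) = 0" if "x \<in> ann sc" for x y
      using that D_leibniz[of x y] D_leibniz[of y x] by (simp add: ann_def)
    then show ?thesis by (auto simp: ann_def)
  qed
  ultimately have "ann sc \<subseteq> span {v \<in> ann sc. \<exists>r. D *v v = r *\<^sub>R v}"
    by (rule selfadjoint_span_eigenvectors[OF linear_matrix_vector D_sym])
  also have "\<dots> \<subseteq> Apos D"
    unfolding Apos_eq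
  proof (rule span_mono, clarify)
    fix v r assume "v \<in> ann sc" "D *v v = r *\<^sub>R v"
    then show "\<exists>r>0. D *v v = r *\<^sub>R v"
      \<comment> \<open>The zero vector satisfies the eigenvalue equation for every number, so
        \<open>1\<close> serves as a positive one.\<close>
      using ann_eigenvalue_positive by (cases "v = 0") (auto intro: exI[of _ 1])
  qed
  finally show ?thesis .
qed

lemma radical_subspace: "subspace (radical sc)"
  using nil_ideal_radical by (simp add: nil_ideal_def alg_ideal_def csubspace_imp_subspace)

lemma Aneg_subset_center: "Aneg D \<subseteq> center sc"
proof -
  have "subspace (center sc)"
    by (auto simp: center_def subspace_def mult_add_left mult_add_right scaleR_eq_smult
        mult_smult_left mult_smult_right)
  then show ?thesis
    unfolding Aneg_eq using negative_eigenvector_central by (intro span_minimal) auto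
qed

lemma Aneg_subset_radical: "Aneg D \<subseteq> radical sc"
proof -
  \<comment> \<open>Passing to \<open>- D\<close> turns negative eigenvalues into positive ones, so
    \<open>positive_nil\<close> applies.\<close>
  interpret neg: filtered_algebra sc "\<lambda>x. - (D *v x)"
    by unfold_locales
      (simp_all add: matrix_vector_right_distrib linear_scale[OF linear_matrix_vector] D_leibniz
        linear_neg[OF linear_mult_left] linear_neg[OF linear_mult_right])
  have "v \<in> radical sc" if "r < 0" "D *v v = r *\<^sub>R v" for r v
  proof -
    have "v \<in> span {v. \<exists>s>0. - (D *v v) = s *\<^sub>R v}"
      using that by (intro span_base CollectI exI[of _ "- r"]) simp
    then show ?thesis
      using neg.positive_nil central_nil_in_radical negative_eigenvector_central[OF that(2,1)] by blast
  qed
  then show ?thesis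
    unfolding Aneg_eq by (intro span_minimal radical_subspace) auto
qed

lemma Apos_subset_radical: "Apos D \<subseteq> radical sc"
proof -
  interpret pos: filtered_algebra sc "(*v) D"
    by unfold_locales
      (simp_all add: matrix_vector_right_distrib linear_scale[OF linear_matrix_vector] D_leibniz)
  define S where "S = {x + y | x y. x \<in> Apos D \<and> y \<in> radical sc}"
  have R: "csubspace (radical sc)" "\<And>x y. x \<in> radical sc \<Longrightarrow> mult sc x y \<in> radical sc"
    "\<And>x y. x \<in> radical sc \<Longrightarrow> mult sc y x \<in> radical sc"
    using nil_ideal_radical by (auto simp: nil_ideal_def alg_ideal_def)
  have S: "subspace S"
    unfolding S_def by (intro csubspace_imp_subspace csubspace_sum Apos_eq R)
  have zero: "0 \<in> Apos D" "0 \<in> radical sc"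
    using Apos_eq(2)[of D] R(1) by (simp_all add: csubspace_def)
  have PS: "x \<in> S" if "x \<in> Apos D" for x using that zero(2) unfolding S_def by force
  have RS: "x \<in> S" if "x \<in> radical sc" for x using that zero(1) unfolding S_def by force
  have gen: "mult sc x y \<in> S \<and> mult sc y x \<in> S"
    if x: "r > 0" "D *v x = r *\<^sub>R x" and y: "D *v y = s *\<^sub>R y" for x y r s
  proof (cases "r + s > 0")
    case True
    then have "mult sc x y \<in> Apos D" "mult sc y x \<in> Apos D"
      using pos.eigen_mult[OF x(2) y] pos.eigen_mult[OF y x(2)]
      by (auto simp: Apos_eq add.commute intro!: span_base)
    then show ?thesis using PS by blast
  next
    \<comment> \<open>Here \<open>s \<le> - r < 0\<close>, so \<open>y\<close> and with it both
      products lie in the radical.\<close>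
    case False
    then have "y \<in> Aneg D"
      using x(1) y by (auto simp: Aneg_eq intro!: span_base exI[of _ s])
    then show ?thesis using Aneg_subset_radical R RS by blast
  qed
  have gen': "mult sc x y \<in> S \<and> mult sc y x \<in> S" if x: "r > 0" "D *v x = r *\<^sub>R x" for x y r
  proof -
    have "span {v. \<exists>r. D *v v = r *\<^sub>R v} \<subseteq> mult sc x -` S \<inter> (\<lambda>y. mult sc y x) -` S"
      using gen[OF x] S
      by (intro span_minimal subspace_inter linear_subspace_vimage linear_mult_left linear_mult_right)
         blast+
    then show ?thesis unfolding eigenvectors_span by blast
  qed
  have mult: "mult sc x y \<in> S" "mult sc y x \<in> S" if "x \<in> Apos D" for x y
  proof -
    have "Apos D \<subseteq> mult sc y -` S \<inter> (\<lambda>x. mult sc x y) -` S"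
      unfolding Apos_eq(1) using gen' S
      by (intro span_minimal subspace_inter linear_subspace_vimage linear_mult_left linear_mult_right)
         blast+
    then show "mult sc x y \<in> S" "mult sc y x \<in> S" using that by blast+
  qed
  have "nil_ideal sc S"
  proof (rule nil_ideal_sum[OF Apos_eq(2) _ mult[unfolded S_def] nil_ideal_radical, folded S_def])
    show "\<exists>k. npow sc x k = 0" if "x \<in> Apos D" for x
      using pos.positive_nil that by (simp add: Apos_eq)
  qed
  then show ?thesis using PS unfolding radical_eq by blast
qed

lemma Aneg_Int_Apos: "Aneg D \<inter> Apos D = {0}"
proof -
  have eig: "v \<bullet> w = 0" if "r < 0" "D *v v = r *\<^sub>R v" "s > 0" "D *v w = s *\<^sub>R w" for v w r s
  proof -
    have "r * (v \<bullet> w) = s * (v \<bullet> w)" using D_sym[of v w] that by simp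
    then show ?thesis using that by simp
  qed
  have "x \<bullet> y = 0" if x: "x \<in> Aneg D" and y: "y \<in> Apos D" for x y
  proof -
    have "orthogonal v y" if "v \<in> {v. \<exists>r<0. D *v v = r *\<^sub>R v}" for v
      using y unfolding Apos_eq
      by (rule orthogonal_to_span) (use that eig in \<open>auto simp: orthogonal_def\<close>)
    then have "orthogonal y x"
      using x unfolding Aneg_eq
      by (intro orthogonal_to_span[of x "{v. \<exists>r<0. D *v v = r *\<^sub>R v}"]) (auto simp: orthogonal_commute)
    then show ?thesis by (simp add: orthogonal_def inner_commute)
  qed
  then have "x = 0" if "x \<in> Aneg D \<inter> Apos D" for x using that by (metis IntE inner_eq_zero_iff)
  moreover have "0 \<in> Aneg D \<inter> Apos D"
    using Aneg_eq(2)[of D] Apos_eq(2)[of D] by (simp add: csubspace_def)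
  ultimately show ?thesis by blast
qed

lemma commutator_closed:
  assumes "A \<in> Azero D" "B \<in> Azero D"
  shows "commutator sc A B \<in> Azero D"
  using assms by (simp add: Azero_eq commutator_def matrix_vector_mult_diff_distrib D_leibniz)

lemma adjoint_closed: "adjoint_closed_lie (commutator sc) (\<lambda>x y. adj (ad x) *v y) (Azero D)"
proof
  fix x y z :: "complex^'n" and r :: real
  show "commutator sc (x + y) z = commutator sc x z + commutator sc y z"
    by (simp add: commutator_def mult_add_left mult_add_right)
  show "commutator sc (r *\<^sub>R x) z = r *\<^sub>R commutator sc x z"
    by (simp add: commutator_def linear_scale[OF linear_mult_left] linear_scale[OF linear_mult_right]
        scaleR_right_diff_distrib)
  show "commutator sc x y = - commutator sc y x" by (simp add: commutator_def)
  show "commutator sc (commutator sc x y) z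
      = commutator sc x (commutator sc y z) - commutator sc y (commutator sc x z)"
    by (simp add: commutator_def mult_diff_left mult_diff_right assoc)
  show "commutator sc x y \<bullet> z = y \<bullet> (adj (ad x) *v z)"
    by (simp add: ad_vec[symmetric] adj_inner)
  show "subspace (Azero D)"
    using linear_subspace_vimage[OF linear_matrix_vector[of D] subspace_single_0]
    by (simp add: Azero_eq vimage_def)
  assume x: "x \<in> Azero D" and y: "y \<in> Azero D"
  show "commutator sc x y \<in> Azero D" by (rule commutator_closed[OF x y])
  \<comment> \<open>For \<open>x\<close> in the kernel, \<open>D\<close> commutes with
    \<open>ad x\<close> and, being self-adjoint, with its adjoint, which therefore preserves the
    kernel.\<close>
  have "D ** ad x - ad x ** D = 0" using ad_weight[of x 0] x by (simp add: Azero_eq)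
  then have "adj (D ** ad x) = adj (ad x ** D)" by simp
  then have "adj (ad x) ** D = D ** adj (ad x)" by (simp add: adj_mult adj_D)
  then have "D *v (adj (ad x) *v y) = adj (ad x) *v (D *v y)"
    by (simp add: matrix_vector_mul_assoc)
  then show "adj (ad x) *v y \<in> Azero D" using y by (simp add: Azero_eq)
  show "adj (ad x) *v commutator sc y z
      = commutator sc (adj (ad x) *v y) z + commutator sc y (adj (ad x) *v z)"
    using derivation_adj_ad[of x] x
    by (simp add: Azero_eq derivation_def commutator_def matrix_vector_mult_diff_distrib)
qed

lemma reductive_Azero: "reductive (Azero D) (commutator sc)"
  unfolding reductive_def
proof (intro allI impI)
  interpret g: adjoint_closed_lie "commutator sc" "\<lambda>x y. adj (ad x) *v y" "Azero D"
    by (rule adjoint_closed)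
  fix I assume "lie_ideal (Azero D) (commutator sc) I"
  then have I: "csubspace I" "I \<subseteq> Azero D" "\<And>x y. x \<in> Azero D \<Longrightarrow> y \<in> I \<Longrightarrow> commutator sc x y \<in> I"
    by (auto simp: lie_ideal_def)
  note I_sub = csubspace_imp_subspace[OF I(1)]
  \<comment> \<open>The orthogonal complement of \<open>I\<close> in the kernel. Real orthogonality
    suffices: \<open>I\<close> is closed under complex scalars, so \<open>J\<close> is too.\<close>
  define J where "J = {x \<in> Azero D. \<forall>y\<in>I. x \<bullet> y = 0}"
  have smult_inner: "(k *s x) \<bullet> y = x \<bullet> (cnj k *s y)" for k and x y :: "complex^'n"
    by (simp add: inner_complex_vec mult_ac)
  have "csubspace J"
    unfolding csubspace_def
  proof (intro conjI ballI allI)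
    show "0 \<in> J" by (simp add: J_def Azero_eq)
    show "x + y \<in> J" if "x \<in> J" "y \<in> J" for x y
      using that by (simp add: J_def Azero_eq matrix_vector_right_distrib inner_add_left)
    show "k *s x \<in> J" if "x \<in> J" for k x
    proof -
      have "cnj k *s y \<in> I" if "y \<in> I" for y using I(1) that by (simp add: csubspace_def)
      then show ?thesis using that by (simp add: J_def Azero_eq matrix_vector_smult smult_inner)
    qed
  qed
  moreover have "commutator sc x y \<in> J" if x: "x \<in> Azero D" and y: "y \<in> J" for x y
  proof -
    have "commutator sc x y \<bullet> z = 0" if z: "z \<in> I" for z
    proof -
      \<comment> \<open>Stability of \<open>I\<close> under the adjoints is what makes its
        complement an ideal.\<close>
      have "adj (ad x) *v z \<in> I"
        using g.ideal_st_closed[OF I_sub I(2,3) x z] by simp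
      then show ?thesis using y by (simp add: g.st J_def)
    qed
    then show ?thesis using x y commutator_closed by (simp add: J_def)
  qed
  ultimately have "lie_ideal (Azero D) (commutator sc) J"
    by (auto simp: lie_ideal_def J_def)
  moreover have "I \<inter> J = {0}"
    using I(1) \<open>csubspace J\<close> by (auto simp: J_def csubspace_def)
  moreover have "Azero D = {x + y | x y. x \<in> I \<and> y \<in> J}"
  proof (intro equalityI subsetI)
    fix x assume x: "x \<in> Azero D"
    obtain y z where yz: "y \<in> span I" "\<And>w. w \<in> span I \<Longrightarrow> orthogonal z w" "x = y + z"
      using orthogonal_subspace_decomp_exists[of I x] by blast
    have "span I = I" using I_sub by (simp add: span_eq_iff)
    with yz have "y \<in> I" "\<forall>w\<in>I. z \<bullet> w = 0" by (auto simp: orthogonal_def)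
    moreover have "z \<in> Azero D"
      using subspace_diff[OF g.g x, of y] \<open>y \<in> I\<close> I(2) yz(3) by auto
    ultimately show "x \<in> {x + y | x y. x \<in> I \<and> y \<in> J}" using yz(3) by (auto simp: J_def)
  next
    fix x assume "x \<in> {x + y | x y. x \<in> I \<and> y \<in> J}"
    then show "x \<in> Azero D" using I(2) subspace_add[OF g.g] by (auto simp: J_def)
  qed
  ultimately show "\<exists>J. lie_ideal (Azero D) (commutator sc) J \<and> I \<inter> J = {0}
      \<and> Azero D = {x + y | x y. x \<in> I \<and> y \<in> J}" by blast
qed

end

theorem theorem4p10:
  fixes sc :: "'n::finite bilin" and c :: real and D :: "complex^'n^'n"
  assumes nonzero: "sc \<noteq> (\<lambda>_ _ _. 0)"
    and assoc: "associative sc"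
    and crit: "Mmu sc = c *\<^sub>R mat 1 + D"
    and der: "derivation sc D"
  shows "ann sc \<subseteq> Apos D
     \<and> Apos D \<subseteq> radical sc
     \<and> Aneg D \<subseteq> center sc \<inter> radical sc
     \<and> Aneg D \<inter> ann sc = {0}
     \<and> (\<forall>A\<in>Azero D. derivation sc (adj (Lmat sc A - Rmat sc A)))
     \<and> (\<forall>A\<in>Azero D. \<forall>B\<in>Azero D. commutator sc A B \<in> Azero D)
     \<and> reductive (Azero D) (commutator sc)"
proof -
  interpret critical_algebra sc c D
    using assms by unfold_locales (auto simp: associative_def)
  have "0 \<in> Aneg D \<inter> ann sc" using Aneg_Int_Apos by (auto simp: ann_def)
  then have "Aneg D \<inter> ann sc = {0}" using Aneg_Int_Apos ann_subset_Apos by blast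
  moreover have "derivation sc (adj (Lmat sc A - Rmat sc A))" if "A \<in> Azero D" for A
    using derivation_adj_ad[of A] that by (simp add: Azero_eq ad_def)
  ultimately show ?thesis
    using ann_subset_Apos Apos_subset_radical Aneg_subset_center Aneg_subset_radical
      commutator_closed reductive_Azero by blast
qed

end
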